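(* Let $\theta\in\mathbb{R}^3$, let $\Gamma$ be a symmetric positive definite $3\times 3$ matrix, let $R$ be a completely-$\mathcal{S}$ $3\times 3$ matrix with $R_{11}=R_{22}=R_{33}=1$, and let $Z$ be a semimartingale reflecting Brownian motion in $\mathbb{R}^3_+$ with data $(\theta,\Gamma,R)$. Suppose that $R$ is nonsingular and $R^{-1}\theta<0$. If there exists a divergent solution of the linear complementarity problem for $(\theta,R)$, that is, vectors $u,v\in\mathbb{R}^3$ with $u,v\ge 0$, $v=\theta+Ru$, $u\cdot v=0$ and $v\ne 0$, then $Z$ is not positive recurrent.
   Context: Vector inequalities are componentwise ($v>0$: all components positive; $v\ge 0$: all components nonnegative). A square matrix $R$ is completely-$\mathcal{S}$ if for each principal submatrix $M$ of $R$ (including $R$ itself) there is a vector $w\ge 0$ with $Mw>0$. SRBM. Put $S=\mathbb{R}^3_+$. A semimartingale reflecting Brownian motion (SRBM) with data $(\theta,\Gamma,R)$ is a continuous adapted process $Z$ with values in $S$, together with probability measures $\{\mathbb{P}_x, x\in S\}$, on a filtered space $(\Omega,\mathcal{F},\{\mathcal{F}_t\})$, such that for each $x\in S$, $\mathbb{P}_x$-a.s.: $Z(t)=X(t)+RY(t)$ for all $t\ge 0$, where $X(t)-\theta t$ is, under $\mathbb{P}_x$, a three-dimensional driftless Brownian motion with covariance matrix $\Gamma$ that starts at $x$ and is an $\{\mathcal{F}_t\}$-martingale; $Y$ is an adapted three-dimensional process, continuous and componentwise nondecreasing with $Y(0)=0$; and $\int_0^\infty 1_{\{Z_j(s)\ne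 0\}}\,dY_j(s)=0$ for $j=1,2,3$. For completely-$\mathcal{S}$ $R$ such a $Z$ exists and is unique in law for each starting state. $Z$ is positive recurrent if $\mathbb{E}_x(\tau_A)<\infty$ for every $x\in S$ and every open neighborhood $A$ of the origin (in $S$), where $\tau_A=\inf\{t\ge 0: Z(t)\in A\}$. *)

theory Defs
  imports "HOL-Probability.Probability"
begin

section \<open>Matrices and the linear complementarity problem\<close>

text \<open>
  The library order \<open><\<close> on vectors means \<open>\<le>\<close> and \<open>\<noteq>\<close>, not
  strict inequality in every component, so all vector inequalities are written out by component.
\<close>

definition nonneg_orthant :: "(real ^ 'n) set" where
  "nonneg_orthant = {z. \<forall>i. 0 \<le> z $ i}"

definition symmetric_positive_definite :: "real ^ 'n ^ 'n \<Rightarrow> bool" where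
  "symmetric_positive_definite A \<longleftrightarrow> transpose A = A \<and> (\<forall>x. x \<noteq> 0 \<longrightarrow> 0 < x \<bullet> (A *v x))"

text \<open>
  Principal submatrices are given by their nonempty index set \<open>I\<close>. Only the components of
  \<open>w\<close> in \<open>I\<close> matter, so \<open>w\<close> stands for a vector indexed by \<open>I\<close>.
\<close>

definition completely_S :: "real ^ 'n ^ 'n \<Rightarrow> bool" where
  "completely_S R \<longleftrightarrow>
     (\<forall>I. I \<noteq> {} \<longrightarrow>
       (\<exists>w :: 'n \<Rightarrow> real. (\<forall>j\<in>I. 0 \<le> w j) \<and> (\<forall>i\<in>I. 0 < (\<Sum>j\<in>I. R $ i $ j * w j))))"

definition lcp_solution :: "real ^ 'n \<Rightarrow> real ^ 'n ^ 'n \<Rightarrow> real ^ 'n \<Rightarrow> real ^ 'n \<Rightarrow> bool" where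
  "lcp_solution \<theta> R u v \<longleftrightarrow>
     (\<forall>i. 0 \<le> u $ i) \<and> (\<forall>i. 0 \<le> v $ i) \<and> v = \<theta> + R *v u \<and> u \<bullet> v = 0"

definition divergent_lcp_solution ::
  "real ^ 'n \<Rightarrow> real ^ 'n ^ 'n \<Rightarrow> real ^ 'n \<Rightarrow> real ^ 'n \<Rightarrow> bool" where
  "divergent_lcp_solution \<theta> R u v \<longleftrightarrow> lcp_solution \<theta> R u v \<and> v \<noteq> 0"

section \<open>Processes in continuous time\<close>

text \<open>
  Processes and filtrations are functions on \<^typ>\<open>real\<close> of which only the values at times
  \<open>t \<ge> 0\<close> are ever used. A filtration consists of sub-sigma-algebras of the measurable space
  \<open>M\<close> (whose measure is irrelevant); neither completeness nor right-continuity is required.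
\<close>

definition filtered_space :: "'w measure \<Rightarrow> (real \<Rightarrow> 'w measure) \<Rightarrow> bool" where
  "filtered_space M F \<longleftrightarrow>
     (\<forall>t\<ge>0. subalgebra M (F t)) \<and> (\<forall>s\<ge>0. \<forall>t\<ge>s. subalgebra (F t) (F s))"

definition adapted :: "(real \<Rightarrow> 'w measure) \<Rightarrow> (real \<Rightarrow> 'w \<Rightarrow> real ^ 'n) \<Rightarrow> bool" where
  "adapted F W \<longleftrightarrow> (\<forall>t\<ge>0. W t \<in> borel_measurable (F t))"

definition martingale ::
  "'w measure \<Rightarrow> (real \<Rightarrow> 'w measure) \<Rightarrow> (real \<Rightarrow> 'w \<Rightarrow> real ^ 'n) \<Rightarrow> bool" where
  "martingale P F W \<longleftrightarrow>
     adapted F W \<and>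
     (\<forall>t\<ge>0. integrable P (W t)) \<and>
     (\<forall>s\<ge>0. \<forall>t\<ge>s. \<forall>i. AE \<omega> in P. real_cond_exp P (F s) (\<lambda>\<omega>. W t \<omega> $ i) \<omega> = W s \<omega> $ i)"

text \<open>Density of the centred normal distribution with (positive definite) covariance \<open>\<Sigma>\<close>.\<close>

definition mvn_density :: "real ^ 'n ^ 'n \<Rightarrow> real ^ 'n \<Rightarrow> real" where
  "mvn_density \<Sigma> y =
     exp (- (y \<bullet> (matrix_inv \<Sigma> *v y)) / 2) / sqrt ((2 * pi) ^ CARD('n) * det \<Sigma>)"

text \<open>
  Independence of increments is required for every finite sequence of times
  \<open>0 \<le> \<tau> 0 \<le> \<dots> \<le> \<tau> n\<close>, presented as an initial segment of an increasing sequence.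
\<close>

definition driftless_brownian_motion ::
  "'w measure \<Rightarrow> real ^ 'n \<Rightarrow> real ^ 'n ^ 'n \<Rightarrow> (real \<Rightarrow> 'w \<Rightarrow> real ^ 'n) \<Rightarrow> bool" where
  "driftless_brownian_motion P x \<Gamma> W \<longleftrightarrow>
     (\<forall>t\<ge>0. W t \<in> borel_measurable P) \<and>
     (AE \<omega> in P. W 0 \<omega> = x) \<and>
     (AE \<omega> in P. continuous_on {0..} (\<lambda>t. W t \<omega>)) \<and>
     (\<forall>s\<ge>0. \<forall>t>s. distributed P lborel (\<lambda>\<omega>. W t \<omega> - W s \<omega>)
        (\<lambda>y. ennreal (mvn_density ((t - s) *\<^sub>R \<Gamma>) y))) \<and>
     (\<forall>\<tau> n. 0 \<le> \<tau> 0 \<and> incseq \<tau> \<longrightarrow>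
        prob_space.indep_vars P (\<lambda>_. borel) (\<lambda>i \<omega>. W (\<tau> (Suc i)) \<omega> - W (\<tau> i) \<omega>) {..<n::nat})"

section \<open>Semimartingale reflecting Brownian motion\<close>

text \<open>
  The integral against \<open>dY\<close> is the Lebesgue-Stieltjes integral on \<open>[0, \<infinity>)\<close>;
  \<^const>\<open>interval_measure\<close> expects a function on the whole line, hence \<open>max 0 s\<close>.
\<close>

definition stieltjes_measure :: "(real \<Rightarrow> real) \<Rightarrow> real measure" where
  "stieltjes_measure y = interval_measure (\<lambda>s. y (max 0 s))"

text \<open>
  \<open>Z\<close>, \<open>P\<close> and the filtration are shared by all starting states; the
  decomposition into \<open>X\<close> and \<open>Y\<close> may depend on the starting state \<open>x\<close>.
\<close>

definition srbm ::
  "'w measure \<Rightarrow> (real \<Rightarrow> 'w measure) \<Rightarrow> (real ^ 'n \<Rightarrow> 'w measure) \<Rightarrow>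
   (real \<Rightarrow> 'w \<Rightarrow> real ^ 'n) \<Rightarrow> real ^ 'n \<Rightarrow> real ^ 'n ^ 'n \<Rightarrow> real ^ 'n ^ 'n \<Rightarrow> bool" where
  "srbm M F P Z \<theta> \<Gamma> R \<longleftrightarrow>
     filtered_space M F \<and>
     adapted F Z \<and>
     (\<forall>\<omega>\<in>space M. continuous_on {0..} (\<lambda>t. Z t \<omega>) \<and> (\<forall>t\<ge>0. Z t \<omega> \<in> nonneg_orthant)) \<and>
     (\<forall>x\<in>nonneg_orthant.
        prob_space (P x) \<and> space (P x) = space M \<and> sets (P x) = sets M \<and>
        (\<exists>X Y.
           driftless_brownian_motion (P x) x \<Gamma> (\<lambda>t \<omega>. X t \<omega> - t *\<^sub>R \<theta>) \<and>
           martingale (P x) F (\<lambda>t \<omega>. X t \<omega> - t *\<^sub>R \<theta>) \<and>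
           adapted F Y \<and>
           (AE \<omega> in P x.
              (\<forall>t\<ge>0. Z t \<omega> = X t \<omega> + R *v Y t \<omega>) \<and>
              Y 0 \<omega> = 0 \<and>
              continuous_on {0..} (\<lambda>t. Y t \<omega>) \<and>
              (\<forall>j. mono_on {0..} (\<lambda>t. Y t \<omega> $ j)) \<and>
              (\<forall>j. (\<integral>\<^sup>+ s\<in>{0..}. indicator {s. Z s \<omega> $ j \<noteq> 0} s
                     \<partial>stieltjes_measure (\<lambda>t. Y t \<omega> $ j)) = 0))))"

text \<open>The infimum is taken in \<^typ>\<open>ennreal\<close>, so it is \<open>\<infinity>\<close> if \<open>A\<close> is never hit.\<close>

definition hitting_time ::
  "(real \<Rightarrow> 'w \<Rightarrow> real ^ 'n) \<Rightarrow> (real ^ 'n) set \<Rightarrow> 'w \<Rightarrow> ennreal" where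
  "hitting_time Z A \<omega> = (INF t\<in>{t. 0 \<le> t \<and> Z t \<omega> \<in> A}. ennreal t)"

definition positive_recurrent ::
  "(real ^ 'n \<Rightarrow> 'w measure) \<Rightarrow> (real \<Rightarrow> 'w \<Rightarrow> real ^ 'n) \<Rightarrow> bool" where
  "positive_recurrent P Z \<longleftrightarrow>
     (\<forall>x\<in>nonneg_orthant. \<forall>A. openin (top_of_set nonneg_orthant) A \<and> 0 \<in> A \<longrightarrow>
        (\<integral>\<^sup>+ \<omega>. hitting_time Z A \<omega> \<partial>P x) < \<infinity>)"

end

theory Submission
  imports Defs
begin

text \<open>
  Under the law started at \<open>x\<close> write \<open>Z t = x + t *\<^sub>R \<theta> + b t + R *v Y t\<close>, where the noise \<open>b\<close> is a
  driftless Brownian motion started at the origin. A divergent solution \<open>(u, v)\<close> of the linear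
  complementarity problem describes a noiseless path \<open>v t\<close> that leaves the origin with the pushing
  \<open>Y t = u t\<close>. The proof starts the process far out, at distance of order \<open>n\<close>, compares it with such a path,
  and shows that the time to come back near the origin has infinite mean.

  Call the noise confined up to time \<open>T\<close> if \<open>\<bar>b t $ l\<bar> \<le> \<epsilon> * (n + t)\<close> for all coordinates \<open>l\<close> and, for one fixed
  vector \<open>a\<close>, also \<open>a \<bullet> b t \<ge> - n\<close>, at all times \<open>t \<le> T\<close>. Two facts are combined.

  Pathwise (\<open>escape_of_divergent_lcp\<close>): for suitable \<open>a\<close>, \<open>\<epsilon>\<close> and \<open>x\<close>, a path whose noise is confined up to
  time \<open>T\<close> does not come near the origin before \<open>T\<close>. Let \<open>v $ k > 0\<close>; then \<open>u $ k = 0\<close>. If a second component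
  \<open>v $ j\<close> is positive, only the third face pushes, its pushing is that of a one-dimensional reflected path,
  and \<open>Z $ j\<close> and \<open>Z $ k\<close> grow at the speeds \<open>v $ j\<close> and \<open>v $ k\<close> (\<open>escape_along_two_axes\<close>). Otherwise \<open>v\<close> lies on the axis
  \<open>k\<close>. If the planar reflection matrix of the other two faces has a positive determinant, their
  pushing cannot deviate from \<open>u t\<close> by more than the size of the noise, and \<open>Z $ k\<close> grows at speed \<open>v $ k\<close>
  (\<open>escape_along_one_axis\<close>). If the determinant is not positive, the solution can be replaced by another
  one in which a single face pushes; that this works for one of the two faces follows from
  \<open>R\<inverse> \<theta> < 0\<close> and the completely-S property by a sign argument for cofactors. In the new solution a component
  \<open>v $ j\<close> may vanish. Then \<open>Z $ j\<close> has no drift to rely on, but it stays above a driftless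
  one-dimensional noise \<open>a \<bullet> b\<close> started at height about \<open>n\<close>; this is the reason for the second condition in
  the definition of confinement.

  Probabilistic (\<open>confinement_event\<close>): for large \<open>n\<close> the noise is confined up to time \<open>T\<close> with probability at
  least a multiple of \<open>1 / (1 + T)\<close>. Stop \<open>a \<bullet> b\<close> when confinement is lost, or at time \<open>T\<close>. The stopped
  variable has mean zero. Loss of confinement contributes about \<open>- n\<close>, except for the overshoot when
  the envelope \<open>\<epsilon> * (n + t)\<close> is left, whose expectation is small by a weighted maximal inequality for fourth
  moments. Paths that are still confined at time \<open>T\<close> contribute at most a multiple of \<open>n + T\<close> each, so they
  must have probability at least of order \<open>n / (n + T)\<close>.

  The tail of the hitting time of a neighbourhood of the origin is therefore at least a multiple of
  \<open>1 / (1 + T)\<close>, which is not integrable.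
\<close>

section \<open>Reflected paths with confined noise\<close>

text \<open>
  The complementarity between \<open>y\<close> and \<open>z\<close> is stated as: \<open>y\<close> does not grow in direction \<open>l\<close> over a
  time interval in which \<open>z\<close> is off the face \<open>l\<close>. Pathwise this is all that the vanishing of the
  Stieltjes integral is used for.
\<close>

definition reflected_path ::
  "real ^ 'n \<Rightarrow> real ^ 'n ^ 'n \<Rightarrow> real ^ 'n \<Rightarrow> real \<Rightarrow>
   (real \<Rightarrow> real ^ 'n) \<Rightarrow> (real \<Rightarrow> real ^ 'n) \<Rightarrow> (real \<Rightarrow> real ^ 'n) \<Rightarrow> bool" where
  "reflected_path \<theta> R x T b y z \<longleftrightarrow>
     (\<forall>t\<in>{0..T}. z t = x + t *\<^sub>R \<theta> + b t + R *v y t) \<and>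
     (\<forall>t\<in>{0..T}. \<forall>l. 0 \<le> z t $ l) \<and>
     continuous_on {0..T} z \<and> b 0 = 0 \<and> y 0 = 0 \<and>
     (\<forall>l. mono_on {0..T} (\<lambda>t. y t $ l)) \<and>
     (\<forall>l s t. 0 \<le> s \<and> s \<le> t \<and> t \<le> T \<and> (\<forall>r\<in>{s<..t}. 0 < z r $ l) \<longrightarrow> y t $ l = y s $ l)"

text \<open>
  The envelope grows linearly in time, with a small slope, so that a positive drift beats it; at
  time \<open>0\<close> it has size proportional to \<open>n\<close>, the scale of the starting point. The extra one-sided
  condition on \<open>a \<bullet> b\<close> is for a coordinate that has no drift at all.
\<close>

definition confined_noise ::
  "real ^ 'n \<Rightarrow> real \<Rightarrow> real \<Rightarrow> real \<Rightarrow> (real \<Rightarrow> real ^ 'n) \<Rightarrow> bool" where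
  "confined_noise a \<epsilon> n T b \<longleftrightarrow>
     (\<forall>t\<in>{0..T}. (\<forall>l. \<bar>b t $ l\<bar> \<le> \<epsilon> * (n + t)) \<and> - n \<le> a \<bullet> b t)"

text \<open>
  The interface between the pathwise and the probabilistic half of the proof. It holds for every
  scale \<open>n \<ge> 2\<close>, since confinement has a good probability only for large \<open>n\<close>.
\<close>

definition escapes_under_confined_noise :: "real ^ 'n \<Rightarrow> real ^ 'n ^ 'n \<Rightarrow> bool" where
  "escapes_under_confined_noise \<theta> R \<longleftrightarrow>
     (\<exists>a \<epsilon>. 0 < \<epsilon> \<and> (\<forall>n\<ge>2. \<exists>x\<in>nonneg_orthant. \<forall>T b y z.
        reflected_path \<theta> R x T b y z \<and> confined_noise a \<epsilon> n T b \<longrightarrow>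
        (\<forall>t\<in>{0..T}. \<exists>l. 1 \<le> z t $ l)))"

text \<open>
  A continuity argument: the bound in \<open>step\<close> may assume that \<open>g\<close> is positive so far, because \<open>g\<close>
  would have to take the value \<open>1 / 2\<close> before it can reach \<open>0\<close>, and positivity up to that time
  forces it to be at least \<open>1\<close> there. It is applied to coordinates of a reflected path: while they
  are positive their faces do not push, and without that push they are seen to be large.
\<close>

lemma stays_above_one:
  fixes g :: "real \<Rightarrow> real"
  assumes cont: "continuous_on {0..T} g" and start: "0 \<le> T \<Longrightarrow> 1 \<le> g 0"
    and step: "\<And>t. t \<in> {0..T} \<Longrightarrow> (\<forall>s\<in>{0..t}. 0 < g s) \<Longrightarrow> 1 \<le> g t"
    and t: "t \<in> {0..T}"
  shows "(\<forall>s\<in>{0..t}. 0 < g s) \<and> 1 \<le> g t"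
proof -
  define B where "B = {s \<in> {0..T}. g s \<le> 1 / 2}"
  have "B = {}"
  proof (rule ccontr)
    assume ne: "B \<noteq> {}"
    have "closed B"
      unfolding B_def by (intro continuous_on_closed_Collect_le cont continuous_on_const) auto
    moreover have "bounded B" by (rule bounded_subset[of "{0..T}"]) (auto simp: B_def)
    ultimately have "compact B" by (simp add: compact_eq_bounded_closed)
    then obtain t0 where t0: "t0 \<in> B" "\<And>s. s \<in> B \<Longrightarrow> t0 \<le> s"
      using compact_attains_inf[of B] ne by blast
    have t0T: "t0 \<in> {0..T}" and gt0: "g t0 \<le> 1/2" using t0 unfolding B_def by auto
    have "g t0 = 1/2"
    proof (rule ccontr)
      assume "g t0 \<noteq> 1/2"
      have "continuous_on {0..t0} g" using cont t0T by (auto intro: continuous_on_subset)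
      then obtain s where s: "0 \<le> s" "s \<le> t0" "g s = 1/2"
        using IVT2'[of g t0 "1/2" 0] gt0 start t0T by auto
      with t0(2)[of s] t0T \<open>g t0 \<noteq> 1/2\<close> show False unfolding B_def by auto
    qed
    moreover have "0 < g s" if "s \<in> {0..t0}" for s
    proof (cases "s \<in> B")
      case True then show ?thesis using t0(2)[OF True] that calculation by (auto simp: antisym)
    next
      case False then show ?thesis using that t0T unfolding B_def by auto
    qed
    ultimately show False using step[OF t0T] by auto
  qed
  then have pos: "0 < g s" if "s \<in> {0..T}" for s using that unfolding B_def by force
  then show ?thesis using step[OF t] t by auto
qed

text \<open>
  After its last visit to the face \<open>l\<close> a path receives no push from there. So \<open>y $ l\<close> can be read
  off at a time at which \<open>z $ l = 0\<close>, which is how upper bounds on the pushing are obtained.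
\<close>

lemma reflected_path_last_zero:
  assumes path: "reflected_path \<theta> R x T b y z" and x: "x $ l = 0" and t: "t \<in> {0..T}"
  obtains s where "s \<in> {0..t}" "z s $ l = 0" "y t $ l = y s $ l"
proof -
  define B where "B = {s \<in> {0..t}. z s $ l = 0}"
  have "z 0 = x" using path t unfolding reflected_path_def by auto
  then have "0 \<in> B" using x t unfolding B_def by auto
  have cont: "continuous_on {0..t} (\<lambda>s. z s $ l)"
    using path t unfolding reflected_path_def by (auto intro!: continuous_intros intro: continuous_on_subset)
  have "closed B"
    unfolding B_def by (rule continuous_closed_preimage_constant) (use cont in auto)
  moreover have "bounded B" by (rule bounded_subset[of "{0..t}"]) (auto simp: B_def)
  ultimately have "compact B" by (simp add: compact_eq_bounded_closed)
  then obtain s where s: "s \<in> B" "\<And>r. r \<in> B \<Longrightarrow> r \<le> s"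
    using compact_attains_sup[of B] \<open>0 \<in> B\<close> by blast
  have "0 < z r $ l" if r: "r \<in> {s<..t}" for r
  proof -
    have "r \<notin> B" using s(2)[of r] r by auto
    moreover have "r \<in> {0..t}" using r s(1) unfolding B_def by auto
    ultimately have "z r $ l \<noteq> 0" unfolding B_def by auto
    moreover have "0 \<le> z r $ l" using path \<open>r \<in> {0..t}\<close> t unfolding reflected_path_def by auto
    ultimately show ?thesis by simp
  qed
  then have "y t $ l = y s $ l"
    using path s(1) t unfolding reflected_path_def B_def by auto
  then show thesis using that s(1) unfolding B_def by auto
qed

lemma reflected_path_no_push:
  assumes "reflected_path \<theta> R x T b y z" and "t \<in> {0..T}" and "\<forall>s\<in>{0..t}. 0 < z s $ l"
  shows "y t $ l = 0"
proof -
  have rule: "\<forall>l s t. 0 \<le> s \<and> s \<le> t \<and> t \<le> T \<and> (\<forall>r\<in>{s<..t}. 0 < z r $ l) \<longrightarrow> y t $ l = y s $ l"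
    and "y 0 = 0"
    using assms(1) unfolding reflected_path_def by blast+
  then show ?thesis using rule[rule_format, of 0 t l] assms(2,3) by auto
qed

lemma UNIV_3_distinct:
  fixes i j k :: 3
  assumes "i \<noteq> j" "i \<noteq> k" "j \<noteq> k"
  shows "UNIV = {i, j, k}"
proof -
  have "card {i, j, k} = CARD(3)" using assms by simp
  then show ?thesis using card_subset_eq[of "UNIV :: 3 set" "{i, j, k}"] by simp
qed

lemma mult_vec_3:
  fixes i j k :: 3 and A :: "real ^ 3 ^ 3"
  assumes "i \<noteq> j" "i \<noteq> k" "j \<noteq> k"
  shows "(A *v w) $ l = A $ l $ i * w $ i + A $ l $ j * w $ j + A $ l $ k * w $ k"
  using assms by (simp add: matrix_vector_mult_def UNIV_3_distinct[OF assms])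

text \<open>
  An error of \<open>C\<close> times the noise envelope is absorbed partly by the starting value \<open>n\<close> and partly by
  the drift \<open>v\<close>.
\<close>

lemma noise_budget:
  fixes C v :: real
  assumes "0 < v" "0 \<le> C"
  obtains \<epsilon> where "0 < \<epsilon>" "\<And>n t. 2 \<le> n \<Longrightarrow> 0 \<le> t \<Longrightarrow> 1 \<le> n + v * t - C * (\<epsilon> * (n + t))"
proof
  define \<epsilon> where "\<epsilon> = min (1/2) v / (1 + C)"
  show "0 < \<epsilon>" using assms unfolding \<epsilon>_def by auto
  have "C * \<epsilon> \<le> min (1/2) v"
  proof -
    have "C * \<epsilon> = C / (1 + C) * min (1/2) v" unfolding \<epsilon>_def by simp
    also have "\<dots> \<le> 1 * min (1/2) v" using assms by (intro mult_right_mono) (auto simp: divide_simps)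
    finally show ?thesis by simp
  qed
  then have le: "C * \<epsilon> \<le> 1/2" "C * \<epsilon> \<le> v" by auto
  fix n t :: real assume "2 \<le> n" "0 \<le> t"
  then have "C * \<epsilon> * n \<le> 1/2 * n" "C * \<epsilon> * t \<le> v * t"
    using le by (auto intro: mult_right_mono)
  moreover have "C * (\<epsilon> * (n + t)) = C * \<epsilon> * n + C * \<epsilon> * t" by (simp add: algebra_simps)
  ultimately show "1 \<le> n + v * t - C * (\<epsilon> * (n + t))" using \<open>2 \<le> n\<close> by linarith
qed

section \<open>One pushing face\<close>

text \<open>
  Only the face \<open>i\<close> pushes in the given solution. Start at height about \<open>n\<close> over the faces \<open>j\<close> and \<open>k\<close>
  and on the face \<open>i\<close>. As long as \<open>z $ j\<close> and \<open>z $ k\<close> are positive, \<open>z $ i\<close> is a one-dimensional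
  reflected path, so its pushing is known up to the size of the noise envelope: \<open>y $ i\<close> is close
  to \<open>u $ i * t\<close>. Hence \<open>z $ k\<close> follows \<open>n + v $ k * t\<close>, and so does \<open>z $ j\<close> if \<open>v $ j > 0\<close>.

  If \<open>v $ j = 0\<close> this comparison gives nothing for \<open>z $ j\<close>. Then eliminate \<open>y $ i\<close>: up to a
  nonnegative drift, \<open>z $ j - R $ j $ i * z $ i\<close> is the driftless noise \<open>a \<bullet> b\<close> with
  \<open>a = e\<^sub>j - R $ j $ i * e\<^sub>i\<close>. Since \<open>R $ j $ i \<ge> 0\<close>, a lower bound on \<open>a \<bullet> b\<close> keeps \<open>z $ j\<close> positive.
\<close>

lemma escape_along_two_axes:
  fixes i j k :: 3 and R :: "real ^ 3 ^ 3"
  assumes ijk: "i \<noteq> j" "i \<noteq> k" "j \<noteq> k"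
    and diag: "\<forall>l. R $ l $ l = 1"
    and lcp: "lcp_solution \<theta> R u v"
    and u: "u $ j = 0" "u $ k = 0"
    and vk: "0 < v $ k"
    and vj: "0 < v $ j \<or> v $ i = 0 \<and> 0 \<le> R $ j $ i"
  shows "escapes_under_confined_noise \<theta> R"
proof -
  have sgn: "0 \<le> u $ i" "0 \<le> v $ i" "0 \<le> v $ j" using lcp unfolding lcp_solution_def by auto
  have "v $ l = \<theta> $ l + R $ l $ i * u $ i" for l
    using lcp u unfolding lcp_solution_def by (auto simp: mult_vec_3[OF ijk])
  then have \<theta>: "\<theta> $ l = v $ l - R $ l $ i * u $ i" for l by simp
  have "u \<bullet> v = 0" using lcp unfolding lcp_solution_def by blast
  then have "u $ i * v $ i = 0"
    using u by (simp add: inner_vec_def UNIV_3_distinct[OF ijk] ijk)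
  then have compl: "u $ i = 0 \<or> v $ i = 0" by simp
  define w where "w = (if 0 < v $ j then min (v $ j) (v $ k) else v $ k)"
  define C where "C = 1 + \<bar>R $ j $ i\<bar> + \<bar>R $ k $ i\<bar>"
  have w: "0 < w" "w \<le> v $ k" "0 < v $ j \<Longrightarrow> w \<le> v $ j" unfolding w_def using vk by auto
  have C: "0 \<le> C" unfolding C_def by auto
  obtain \<epsilon> where \<epsilon>: "0 < \<epsilon>"
    "\<And>n t. 2 \<le> n \<Longrightarrow> 0 \<le> t \<Longrightarrow> 1 \<le> n + w * t - C * (\<epsilon> * (n + t))"
    using noise_budget[OF w(1) C] by blast
  define a :: "real ^ 3" where "a = axis j 1 - R $ j $ i *\<^sub>R axis i 1"
  have a: "a \<bullet> p = p $ j - R $ j $ i * p $ i" for p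
    unfolding a_def by (simp add: inner_diff_left inner_axis' )
  show ?thesis
    unfolding escapes_under_confined_noise_def
  proof (intro exI conjI allI impI)
    show "0 < \<epsilon>" by fact
    fix n :: real assume n: "2 \<le> n"
    define x :: "real ^ 3" where "x = (n + 1) *\<^sub>R axis j 1 + n *\<^sub>R axis k 1"
    have x: "x $ i = 0" "x $ j = n + 1" "x $ k = n"
      unfolding x_def using ijk by (auto simp: axis_def)
    have xin: "x \<in> nonneg_orthant"
      unfolding x_def nonneg_orthant_def using n by (auto simp: axis_def)
    have "\<exists>l. 1 \<le> z t $ l"
      if path: "reflected_path \<theta> R x T b y z" and noise: "confined_noise a \<epsilon> n T b"
        and t: "t \<in> {0..T}" for T b y z t
    proof -
      have z: "z s $ l = x $ l + s * \<theta> $ l + b s $ l + (R *v y s) $ l" and z0: "0 \<le> z s $ l"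
        if "s \<in> {0..T}" for s l
        using path that unfolding reflected_path_def by auto
      have bnd: "\<bar>b s $ l\<bar> \<le> \<epsilon> * (n + s)" and ab: "- n \<le> a \<bullet> b s" if "s \<in> {0..T}" for s l
        using noise that unfolding confined_noise_def by auto
      have "1 \<le> min (z t $ j) (z t $ k)"
      proof (rule conjunct2[OF stays_above_one[OF _ _ _ t]])
        show "continuous_on {0..T} (\<lambda>t. min (z t $ j) (z t $ k))"
          using path unfolding reflected_path_def by (auto intro!: continuous_intros)
        show "1 \<le> min (z 0 $ j) (z 0 $ k)" if "0 \<le> T"
        proof -
          have "z 0 = x" using path that unfolding reflected_path_def by auto
          then show ?thesis using x n by auto
        qed
        fix t assume t: "t \<in> {0..T}" and "\<forall>s\<in>{0..t}. 0 < min (z s $ j) (z s $ k)"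
        then have pos: "0 < z s $ j" "0 < z s $ k" if "s \<in> {0..t}" for s using that by auto
        have y0: "y s $ j = 0" "y s $ k = 0" if "s \<in> {0..t}" for s
          using that t pos by (auto intro!: reflected_path_no_push[OF path])
        have zl: "z s $ l = x $ l + s * \<theta> $ l + b s $ l + R $ l $ i * y s $ i" if "s \<in> {0..t}" for s l
          using z[of s l] y0[OF that] that t by (auto simp: mult_vec_3[OF ijk])
        define e where "e = \<epsilon> * (n + t)"
        have be: "\<bar>b s $ l\<bar> \<le> e" if "s \<in> {0..t}" for s l
        proof -
          have "\<epsilon> * (n + s) \<le> e" unfolding e_def using that \<epsilon>(1) by auto
          then show ?thesis using bnd[of s l] that t by auto
        qed
        have e0: "0 \<le> e" using be[of 0 i] t by auto
        obtain s where s: "s \<in> {0..t}" "z s $ i = 0" "y t $ i = y s $ i"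
          using reflected_path_last_zero[OF path x(1) t] by blast
        have ys: "y s $ i = u $ i * s - v $ i * s - b s $ i"
          using zl[OF s(1), of i] s(2) x diag \<theta>[of i] by (simp add: algebra_simps)
        \<comment> \<open>At the last zero \<open>s\<close> of \<open>z $ i\<close> the pushing equals the drift towards the face minus the noise.\<close>
        have up: "y t $ i - u $ i * t \<le> e"
        proof -
          have "u $ i * s \<le> u $ i * t" "0 \<le> v $ i * s" using sgn s(1) by (auto intro: mult_left_mono)
          then show ?thesis using ys s(3) be[OF s(1), of i] by linarith
        qed
        have tt: "t \<in> {0..t}" using t by auto
        have "mono_on {0..T} (\<lambda>t. y t $ i)" "y 0 = 0" using path unfolding reflected_path_def by auto
        then have "0 \<le> y t $ i"
          using mono_onD[of "{0..T}" "\<lambda>t. y t $ i" 0 t] t by auto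
        moreover have "- e \<le> y t $ i - u $ i * t" if "v $ i = 0"
          using zl[OF tt, of i] z0[OF t, of i] x diag \<theta>[of i] be[OF tt, of i] that by (simp add: algebra_simps)
        ultimately have lo: "- e \<le> y t $ i - u $ i * t"
          using compl e0 by auto
        have gen: "x $ l + w * t - C * e \<le> z t $ l"
          if l: "w \<le> v $ l" "\<bar>R $ l $ i\<bar> \<le> C - 1" for l
        proof -
          have eq: "z t $ l = x $ l + v $ l * t + b t $ l + R $ l $ i * (y t $ i - u $ i * t)"
            using zl[OF tt, of l] \<theta>[of l] by (simp add: algebra_simps)
          have "\<bar>R $ l $ i * (y t $ i - u $ i * t)\<bar> \<le> (C - 1) * e"
            unfolding abs_mult using up lo l C e0 by (intro mult_mono) auto
          moreover have "w * t \<le> v $ l * t" using l t by (auto intro: mult_right_mono)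
          moreover have "C * e = (C - 1) * e + e" by (simp add: algebra_simps)
          ultimately show ?thesis using be[OF tt, of l] eq by linarith
        qed
        have t0: "0 \<le> t" using t by auto
        have k: "1 \<le> z t $ k"
          using gen[of k] w(2) \<epsilon>(2)[OF n t0] x unfolding C_def e_def by auto
        have "1 \<le> z t $ j"
        proof (cases "0 < v $ j")
          case True
          then show ?thesis using gen[of j] w(3) \<epsilon>(2)[OF n t0] x unfolding C_def e_def by auto
        next
          case False
          then have vi: "v $ i = 0" "0 \<le> R $ j $ i" using vj by auto
          have "y t $ i = z t $ i - b t $ i + u $ i * t"
            using zl[OF tt, of i] x diag \<theta>[of i] vi by (simp add: algebra_simps)
          then have "z t $ j = n + 1 + t * (v $ j - R $ j $ i * u $ i) + b t $ j + R $ j $ i * (z t $ i - b t $ i + u $ i * t)"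
            using zl[OF tt, of j] \<theta>[of j] x by simp
          then have "z t $ j = n + 1 + v $ j * t + a \<bullet> b t + R $ j $ i * z t $ i"
            by (simp add: a algebra_simps)
          moreover have "0 \<le> R $ j $ i * z t $ i" "0 \<le> v $ j * t" using vi z0[OF t] sgn t0 by auto
          ultimately show ?thesis using ab[OF t] by linarith
        qed
        with k show "1 \<le> min (z t $ j) (z t $ k)" by simp
      qed
      then show ?thesis by auto
    qed
    then show "\<exists>x\<in>nonneg_orthant. \<forall>T b y z. reflected_path \<theta> R x T b y z \<and> confined_noise a \<epsilon> n T b \<longrightarrow>
        (\<forall>t\<in>{0..T}. \<exists>l. 1 \<le> z t $ l)"
      using xin by blast
  qed
qed

section \<open>Two pushing faces\<close>

lemma bound_from_coupled_inequalities:
  fixes m m' \<alpha> \<alpha>' \<kappa> :: real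
  assumes "m \<le> \<alpha> * m' + \<kappa>" "m' \<le> \<alpha>' * m + \<kappa>" "0 \<le> \<alpha>" "\<alpha> * \<alpha>' < 1"
  shows "m \<le> (1 + \<alpha>) * \<kappa> / (1 - \<alpha> * \<alpha>')"
proof -
  have "\<alpha> * m' \<le> \<alpha> * (\<alpha>' * m + \<kappa>)" using assms by (intro mult_left_mono) auto
  then have "m * (1 - \<alpha> * \<alpha>') \<le> (1 + \<alpha>) * \<kappa>" using assms(1) by (simp add: algebra_simps)
  then show ?thesis using assms(4) by (simp add: pos_le_divide_eq)
qed

text \<open>
  The value of this constant is irrelevant; what matters is that it depends on the reflection matrix
  only, so that the width \<open>\<epsilon>\<close> of the noise envelope can be chosen small compared to its inverse.
\<close>

definition planar_reflection_const :: "real \<Rightarrow> real \<Rightarrow> real" where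
  "planar_reflection_const p q =
     (1 + \<bar>p\<bar> + \<bar>q\<bar>) / (1 - p * q) *
     (1 + 2 * (1 + \<bar>p\<bar> + \<bar>q\<bar>) * ((1 + \<bar>p\<bar>) * (1 + \<bar>q\<bar>)) * (1 + 1 / (1 - p * q)))"

text \<open>
  The planar reflection matrix with rows \<open>(1, p)\<close> and \<open>(q, 1)\<close> has determinant \<open>D = 1 - p * q > 0\<close>.
  A planar path \<open>(\<zeta>, \<zeta>')\<close> starts at the origin and \<open>\<eta>\<close>, \<open>\<eta>'\<close> measure by how much the pushing exceeds
  that of the complementarity solution; between visits to its face, \<open>\<eta>\<close> can only decrease. The
  claim is that noise of size \<open>e\<close> causes deviations of order \<open>e\<close> only.

  Eliminating \<open>\<eta>'\<close> leaves \<open>\<zeta> - p * \<zeta>' = noise + D * \<eta>\<close>. Comparing a time \<open>r\<close> with the last zero \<open>s\<close> of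
  \<open>\<zeta>\<close> before it yields \<open>\<zeta> r \<le> p * (\<zeta>' r - \<zeta>' s) + noise\<close>, as \<open>D > 0\<close>, and symmetrically for \<open>\<zeta>'\<close>. If \<open>p\<close>
  and \<open>q\<close> have the same sign, these two inequalities are coupled with the factor \<open>p * q < 1\<close>: at the
  same time if both are nonnegative, for the maxima over the whole interval if both are nonpositive.
  If the signs differ, one of the inequalities bounds its coordinate at the zeros of the other one,
  and this bound is then fed into the remaining inequality.
\<close>

lemma planar_reflection_bound:
  fixes p q t e :: real and \<zeta> \<zeta>' \<beta> \<beta>' \<eta> \<eta>' :: "real \<Rightarrow> real"
  assumes pq: "p * q < 1"
    and t: "0 \<le> t" and cont: "continuous_on {0..t} \<zeta>" "continuous_on {0..t} \<zeta>'"
    and eq: "\<And>s. s \<in> {0..t} \<Longrightarrow> \<zeta> s = \<beta> s + \<eta> s + p * \<eta>' s"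
      "\<And>s. s \<in> {0..t} \<Longrightarrow> \<zeta>' s = \<beta>' s + q * \<eta> s + \<eta>' s"
    and nn: "\<And>s. s \<in> {0..t} \<Longrightarrow> 0 \<le> \<zeta> s" "\<And>s. s \<in> {0..t} \<Longrightarrow> 0 \<le> \<zeta>' s"
    and be: "\<And>s. s \<in> {0..t} \<Longrightarrow> \<bar>\<beta> s\<bar> \<le> e" "\<And>s. s \<in> {0..t} \<Longrightarrow> \<bar>\<beta>' s\<bar> \<le> e"
    and last: "\<And>r. r \<in> {0..t} \<Longrightarrow> \<exists>s\<in>{0..r}. \<zeta> s = 0 \<and> \<eta> r \<le> \<eta> s"
      "\<And>r. r \<in> {0..t} \<Longrightarrow> \<exists>s\<in>{0..r}. \<zeta>' s = 0 \<and> \<eta>' r \<le> \<eta>' s"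
  shows "\<bar>\<eta> t\<bar> \<le> planar_reflection_const p q * e \<and> \<bar>\<eta>' t\<bar> \<le> planar_reflection_const p q * e"
proof -
  define D where "D = 1 - p * q"
  define \<kappa> where "\<kappa> = 2 * (1 + \<bar>p\<bar> + \<bar>q\<bar>)"
  define H where "H = (1 + \<bar>p\<bar>) * (1 + \<bar>q\<bar>)"
  define G where "G = \<kappa> * H * (1 + 1 / D)"
  have D: "0 < D" and \<kappa>: "0 \<le> \<kappa>" and H0: "0 \<le> H" unfolding D_def \<kappa>_def H_def using pq by auto
  have G: "0 \<le> G" unfolding G_def using D \<kappa> H0 by auto
  have C: "planar_reflection_const p q = (1 + \<bar>p\<bar> + \<bar>q\<bar>) / D * (1 + G)"
    unfolding planar_reflection_const_def G_def H_def \<kappa>_def D_def ..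
  have e: "0 \<le> e" using be(1)[of 0] t by auto
  have elim: "D * \<eta> s = \<zeta> s - p * \<zeta>' s - (\<beta> s - p * \<beta>' s)" "D * \<eta>' s = \<zeta>' s - q * \<zeta> s - (\<beta>' s - q * \<beta> s)"
    if "s \<in> {0..t}" for s
    unfolding D_def using eq[OF that] by (simp_all add: algebra_simps)
  define E where "E = e + \<bar>p\<bar> * e + \<bar>q\<bar> * e"
  have \<kappa>e: "\<kappa> * e = 2 * E" unfolding \<kappa>_def E_def by (simp add: algebra_simps)
  have noise: "- E \<le> \<beta> s - p * \<beta>' s" "\<beta> s - p * \<beta>' s \<le> E" "- E \<le> \<beta>' s - q * \<beta> s" "\<beta>' s - q * \<beta> s \<le> E"
    if "s \<in> {0..t}" for s
  proof -
    have "\<bar>p * \<beta>' s\<bar> \<le> \<bar>p\<bar> * e" "\<bar>q * \<beta> s\<bar> \<le> \<bar>q\<bar> * e"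
      unfolding abs_mult using be[OF that] by (auto intro: mult_left_mono)
    moreover have "0 \<le> \<bar>p\<bar> * e" "0 \<le> \<bar>q\<bar> * e" using e by auto
    ultimately have "\<bar>p * \<beta>' s\<bar> \<le> E - e" "\<bar>q * \<beta> s\<bar> \<le> E - e" unfolding E_def by linarith+
    then show "- E \<le> \<beta> s - p * \<beta>' s" "\<beta> s - p * \<beta>' s \<le> E" "- E \<le> \<beta>' s - q * \<beta> s" "\<beta>' s - q * \<beta> s \<le> E"
      using be[OF that] by linarith+
  qed
  have A: "\<exists>s\<in>{0..r}. \<zeta> s = 0 \<and> \<zeta> r \<le> p * \<zeta>' r - p * \<zeta>' s + \<kappa> * e" if r: "r \<in> {0..t}" for r
  proof -
    obtain s where s: "s \<in> {0..r}" "\<zeta> s = 0" "\<eta> r \<le> \<eta> s" using last(1)[OF r] by auto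
    have st: "s \<in> {0..t}" using s r by auto
    have "D * \<eta> r \<le> D * \<eta> s" using s D by (intro mult_left_mono) auto
    then have "\<zeta> r \<le> p * \<zeta>' r - p * \<zeta>' s + \<kappa> * e"
      using elim(1)[OF r] elim(1)[OF st] s(2) noise[OF r] noise[OF st] \<kappa>e by linarith
    then show ?thesis using s by auto
  qed
  have B: "\<exists>s\<in>{0..r}. \<zeta>' s = 0 \<and> \<zeta>' r \<le> q * \<zeta> r - q * \<zeta> s + \<kappa> * e" if r: "r \<in> {0..t}" for r
  proof -
    obtain s where s: "s \<in> {0..r}" "\<zeta>' s = 0" "\<eta>' r \<le> \<eta>' s" using last(2)[OF r] by auto
    have st: "s \<in> {0..t}" using s r by auto
    have "D * \<eta>' r \<le> D * \<eta>' s" using s D by (intro mult_left_mono) auto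
    then have "\<zeta>' r \<le> q * \<zeta> r - q * \<zeta> s + \<kappa> * e"
      using elim(2)[OF r] elim(2)[OF st] s(2) noise[OF r] noise[OF st] \<kappa>e by linarith
    then show ?thesis using s by auto
  qed
  have tt: "t \<in> {0..t}" using t by auto
  have small: "c * (\<kappa> * e) \<le> G * e" "c * (\<kappa> * e) / D \<le> G * e" if "c \<le> H" for c
  proof -
    have K: "0 \<le> \<kappa> * e" "0 \<le> \<kappa> * e / D" using \<kappa> e D by auto
    have "G * e = H * (\<kappa> * e) + H * (\<kappa> * e / D)"
      unfolding G_def using D by (simp add: field_simps)
    then show "c * (\<kappa> * e) \<le> G * e" "c * (\<kappa> * e) / D \<le> G * e"
      using mult_right_mono[OF that K(1)] mult_right_mono[OF that K(2)] mult_nonneg_nonneg[OF H0 K(1)]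
        mult_nonneg_nonneg[OF H0 K(2)] by simp_all
  qed
  have H: "1 + \<bar>p\<bar> \<le> H" "1 + \<bar>q\<bar> \<le> H" "1 + \<bar>q\<bar> * (1 + \<bar>p\<bar>) \<le> H" "1 + \<bar>p\<bar> * (1 + \<bar>q\<bar>) \<le> H"
    unfolding H_def by (auto simp: algebra_simps)
  have main: "\<zeta> t \<le> G * e \<and> \<zeta>' t \<le> G * e"
  proof -
    consider (pp) "0 \<le> p" "0 \<le> q" | (nn) "p \<le> 0" "q \<le> 0" | (pn) "0 \<le> p" "q \<le> 0" | (np) "p \<le> 0" "0 \<le> q"
      by linarith
    then show ?thesis
    proof cases
      case pp
      obtain s s' where s: "s \<in> {0..t}" "\<zeta> t \<le> p * \<zeta>' t - p * \<zeta>' s + \<kappa> * e"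
        "s' \<in> {0..t}" "\<zeta>' t \<le> q * \<zeta> t - q * \<zeta> s' + \<kappa> * e"
        using A[OF tt] B[OF tt] by auto
      have "0 \<le> p * \<zeta>' s" "0 \<le> q * \<zeta> s'" using pp nn s by auto
      then have "\<zeta> t \<le> p * \<zeta>' t + \<kappa> * e" "\<zeta>' t \<le> q * \<zeta> t + \<kappa> * e" using s by auto
      then have "\<zeta> t \<le> (1 + p) * (\<kappa> * e) / (1 - p * q)" "\<zeta>' t \<le> (1 + q) * (\<kappa> * e) / (1 - q * p)"
        using bound_from_coupled_inequalities[of "\<zeta> t" p "\<zeta>' t" "\<kappa> * e" q]
          bound_from_coupled_inequalities[of "\<zeta>' t" q "\<zeta> t" "\<kappa> * e" p] pq pp by (auto simp: mult.commute)
      then show ?thesis using small(2)[OF H(1)] small(2)[OF H(2)] pp unfolding D_def by (auto simp: mult.commute[of q p])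
    next
      case nn
      obtain r where r: "r \<in> {0..t}" "\<And>s. s \<in> {0..t} \<Longrightarrow> \<zeta> s \<le> \<zeta> r"
        using continuous_attains_sup[OF _ _ cont(1)] t by auto
      obtain r' where r': "r' \<in> {0..t}" "\<And>s. s \<in> {0..t} \<Longrightarrow> \<zeta>' s \<le> \<zeta>' r'"
        using continuous_attains_sup[OF _ _ cont(2)] t by auto
      obtain s s' where s: "s \<in> {0..r}" "\<zeta> r \<le> p * \<zeta>' r - p * \<zeta>' s + \<kappa> * e"
        "s' \<in> {0..r'}" "\<zeta>' r' \<le> q * \<zeta> r' - q * \<zeta> s' + \<kappa> * e"
        using A[OF r(1)] B[OF r'(1)] by auto
      have "p * \<zeta>' r \<le> 0" "q * \<zeta> r' \<le> 0"
        using nn \<open>\<And>s. s \<in> {0..t} \<Longrightarrow> 0 \<le> \<zeta> s\<close> \<open>\<And>s. s \<in> {0..t} \<Longrightarrow> 0 \<le> \<zeta>' s\<close> r(1) r'(1)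
        by (auto simp: mult_nonpos_nonneg)
      moreover have "- p * \<zeta>' s \<le> - p * \<zeta>' r'" "- q * \<zeta> s' \<le> - q * \<zeta> r"
        using nn r r' s by (auto intro!: mult_left_mono_neg)
      ultimately have "\<zeta> r \<le> (- p) * \<zeta>' r' + \<kappa> * e" "\<zeta>' r' \<le> (- q) * \<zeta> r + \<kappa> * e" using s by auto
      then have "\<zeta> r \<le> (1 + - p) * (\<kappa> * e) / (1 - (- p) * (- q))" "\<zeta>' r' \<le> (1 + - q) * (\<kappa> * e) / (1 - (- q) * (- p))"
        using bound_from_coupled_inequalities[of "\<zeta> r" "- p" "\<zeta>' r'" "\<kappa> * e" "- q"]
          bound_from_coupled_inequalities[of "\<zeta>' r'" "- q" "\<zeta> r" "\<kappa> * e" "- p"] pq nn by (auto simp: mult.commute)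
      then have "\<zeta> r \<le> G * e" "\<zeta>' r' \<le> G * e" using small(2)[OF H(1)] small(2)[OF H(2)] nn unfolding D_def by (auto simp: mult.commute[of q p])
      then show ?thesis using r(2)[OF tt] r'(2)[OF tt] by auto
    next
      case np
      obtain s where s: "s \<in> {0..t}" "\<zeta> s = 0" "\<zeta> t \<le> p * \<zeta>' t - p * \<zeta>' s + \<kappa> * e"
        using A[OF tt] by auto
      obtain s2 where s2: "s2 \<in> {0..s}" "\<zeta>' s \<le> q * \<zeta> s - q * \<zeta> s2 + \<kappa> * e" using B[OF s(1)] by auto
      have "0 \<le> q * \<zeta> s2" using np nn s s2 by auto
      then have "\<zeta>' s \<le> \<kappa> * e" using s2 s by auto
      then have "- p * \<zeta>' s \<le> - p * (\<kappa> * e)" using np by (intro mult_left_mono) auto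
      moreover have "p * \<zeta>' t \<le> 0" using np nn(2)[OF tt] by (auto simp: mult_nonpos_nonneg)
      ultimately have 1: "\<zeta> t \<le> (1 + \<bar>p\<bar>) * (\<kappa> * e)" using s np by (auto simp: algebra_simps)
      obtain s3 where s3: "s3 \<in> {0..t}" "\<zeta>' t \<le> q * \<zeta> t - q * \<zeta> s3 + \<kappa> * e" using B[OF tt] by auto
      have "0 \<le> q * \<zeta> s3" using np nn s3 by auto
      moreover have "q * \<zeta> t \<le> q * ((1 + \<bar>p\<bar>) * (\<kappa> * e))" using 1 np by (intro mult_left_mono) auto
      ultimately have "\<zeta>' t \<le> (1 + \<bar>q\<bar> * (1 + \<bar>p\<bar>)) * (\<kappa> * e)" using s3 np by (auto simp: algebra_simps)
      then show ?thesis using 1 small(1)[OF H(1)] small(1)[OF H(2)] small(1)[OF H(3)] small(1)[OF H(4)] by linarith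
    next
      case pn
      obtain s where s: "s \<in> {0..t}" "\<zeta>' s = 0" "\<zeta>' t \<le> q * \<zeta> t - q * \<zeta> s + \<kappa> * e"
        using B[OF tt] by auto
      obtain s2 where s2: "s2 \<in> {0..s}" "\<zeta> s \<le> p * \<zeta>' s - p * \<zeta>' s2 + \<kappa> * e" using A[OF s(1)] by auto
      have "0 \<le> p * \<zeta>' s2" using pn nn s s2 by auto
      then have "\<zeta> s \<le> \<kappa> * e" using s2 s by auto
      then have "- q * \<zeta> s \<le> - q * (\<kappa> * e)" using pn by (intro mult_left_mono) auto
      moreover have "q * \<zeta> t \<le> 0" using pn nn(1)[OF tt] by (auto simp: mult_nonpos_nonneg)
      ultimately have 1: "\<zeta>' t \<le> (1 + \<bar>q\<bar>) * (\<kappa> * e)" using s pn by (auto simp: algebra_simps)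
      obtain s3 where s3: "s3 \<in> {0..t}" "\<zeta> t \<le> p * \<zeta>' t - p * \<zeta>' s3 + \<kappa> * e" using A[OF tt] by auto
      have "0 \<le> p * \<zeta>' s3" using pn nn s3 by auto
      moreover have "p * \<zeta>' t \<le> p * ((1 + \<bar>q\<bar>) * (\<kappa> * e))" using 1 pn by (intro mult_left_mono) auto
      ultimately have "\<zeta> t \<le> (1 + \<bar>p\<bar> * (1 + \<bar>q\<bar>)) * (\<kappa> * e)" using s3 pn by (auto simp: algebra_simps)
      then show ?thesis using 1 small(1)[OF H(1)] small(1)[OF H(2)] small(1)[OF H(3)] small(1)[OF H(4)] by linarith
    qed
  qed
  have Ge: "0 \<le> G * e" using G e by simp
  have "\<bar>p * \<zeta>' t\<bar> \<le> \<bar>p\<bar> * (G * e)" "\<bar>q * \<zeta> t\<bar> \<le> \<bar>q\<bar> * (G * e)"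
    unfolding abs_mult using main nn[OF tt] by (auto intro: mult_left_mono)
  then have "\<bar>D * \<eta> t\<bar> \<le> (1 + \<bar>p\<bar> + \<bar>q\<bar>) * (G + 1) * e" "\<bar>D * \<eta>' t\<bar> \<le> (1 + \<bar>p\<bar> + \<bar>q\<bar>) * (G + 1) * e"
  proof -
    have x: "(1 + \<bar>p\<bar> + \<bar>q\<bar>) * (G + 1) * e = G * e + \<bar>p\<bar> * (G * e) + \<bar>q\<bar> * (G * e) + E"
      unfolding E_def by (simp add: algebra_simps)
    have "0 \<le> \<bar>p\<bar> * (G * e)" "0 \<le> \<bar>q\<bar> * (G * e)" using Ge by auto
    then have "\<bar>\<zeta> t - p * \<zeta>' t\<bar> \<le> G * e + \<bar>p\<bar> * (G * e) + \<bar>q\<bar> * (G * e)"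
        "\<bar>\<zeta>' t - q * \<zeta> t\<bar> \<le> G * e + \<bar>p\<bar> * (G * e) + \<bar>q\<bar> * (G * e)"
      using \<open>\<bar>p * \<zeta>' t\<bar> \<le> \<bar>p\<bar> * (G * e)\<close> \<open>\<bar>q * \<zeta> t\<bar> \<le> \<bar>q\<bar> * (G * e)\<close> main nn[OF tt] by linarith+
    then show "\<bar>D * \<eta> t\<bar> \<le> (1 + \<bar>p\<bar> + \<bar>q\<bar>) * (G + 1) * e" "\<bar>D * \<eta>' t\<bar> \<le> (1 + \<bar>p\<bar> + \<bar>q\<bar>) * (G + 1) * e"
      unfolding x using elim[OF tt] noise[OF tt] by linarith+
  qed
  then have "\<bar>\<eta> t\<bar> \<le> (1 + \<bar>p\<bar> + \<bar>q\<bar>) * (G + 1) * e / D" "\<bar>\<eta>' t\<bar> \<le> (1 + \<bar>p\<bar> + \<bar>q\<bar>) * (G + 1) * e / D"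
    unfolding abs_mult using D by (simp_all add: pos_le_divide_eq mult.commute)
  then show ?thesis unfolding C by (simp add: add.commute)
qed

text \<open>
  The solution has \<open>v\<close> on the axis \<open>k\<close>, and the faces \<open>i\<close> and \<open>j\<close> form a planar reflection problem with
  positive determinant. Starting from height \<open>n\<close> on the axis, the pair of these two coordinates stays
  near \<open>0\<close> and their pushing near \<open>u * t\<close> until \<open>z $ k\<close> vanishes, which therefore never happens.
\<close>

lemma escape_along_one_axis:
  fixes i j k :: 3 and R :: "real ^ 3 ^ 3"
  assumes ijk: "i \<noteq> j" "i \<noteq> k" "j \<noteq> k"
    and diag: "\<forall>l. R $ l $ l = 1"
    and lcp: "lcp_solution \<theta> R u v"
    and v: "v $ i = 0" "v $ j = 0" "0 < v $ k"
    and det: "R $ i $ j * R $ j $ i < 1"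
  shows "escapes_under_confined_noise \<theta> R"
proof -
  have sgn: "0 \<le> u $ i" "0 \<le> u $ j" using lcp unfolding lcp_solution_def by auto
  have "u \<bullet> v = 0" using lcp unfolding lcp_solution_def by blast
  then have "u $ k * v $ k = 0"
    using v by (simp add: inner_vec_def UNIV_3_distinct[OF ijk] ijk)
  then have uk: "u $ k = 0" using v by simp
  have "v $ l = \<theta> $ l + R $ l $ i * u $ i + R $ l $ j * u $ j" for l
    using lcp uk unfolding lcp_solution_def by (auto simp: mult_vec_3[OF ijk])
  then have \<theta>: "\<theta> $ l = v $ l - R $ l $ i * u $ i - R $ l $ j * u $ j" for l by simp
  define C where "C = planar_reflection_const (R $ i $ j) (R $ j $ i)"
  have C: "0 \<le> C" unfolding C_def planar_reflection_const_def using det by auto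
  define C' where "C' = 1 + \<bar>R $ k $ i\<bar> * C + \<bar>R $ k $ j\<bar> * C"
  have C': "0 \<le> C'" unfolding C'_def using C by auto
  obtain \<epsilon> where \<epsilon>: "0 < \<epsilon>"
    "\<And>n t. 2 \<le> n \<Longrightarrow> 0 \<le> t \<Longrightarrow> 1 \<le> n + v $ k * t - C' * (\<epsilon> * (n + t))"
    using noise_budget[OF v(3) C'] by blast
  show ?thesis
    unfolding escapes_under_confined_noise_def
  proof (rule exI[of _ 0], rule exI[of _ \<epsilon>], intro conjI allI impI)
    show "0 < \<epsilon>" by fact
    fix n :: real assume n: "2 \<le> n"
    define x :: "real ^ 3" where "x = n *\<^sub>R axis k 1"
    have x: "x $ i = 0" "x $ j = 0" "x $ k = n"
      unfolding x_def using ijk by (auto simp: axis_def)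
    have xin: "x \<in> nonneg_orthant"
      unfolding x_def nonneg_orthant_def using n by (auto simp: axis_def)
    have "\<exists>l. 1 \<le> z t $ l"
      if path: "reflected_path \<theta> R x T b y z" and noise: "confined_noise 0 \<epsilon> n T b"
        and t: "t \<in> {0..T}" for T b y z t
    proof -
      have z: "z s $ l = x $ l + s * \<theta> $ l + b s $ l + (R *v y s) $ l" and z0: "0 \<le> z s $ l"
        if "s \<in> {0..T}" for s l
        using path that unfolding reflected_path_def by auto
      have bnd: "\<bar>b s $ l\<bar> \<le> \<epsilon> * (n + s)" if "s \<in> {0..T}" for s l
        using noise that unfolding confined_noise_def by auto
      have cz: "continuous_on {0..T} (\<lambda>t. z t $ l)" for l
        using path unfolding reflected_path_def by (auto intro!: continuous_intros)
      have "1 \<le> z t $ k"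
      proof (rule conjunct2[OF stays_above_one[OF _ _ _ t]])
        show "continuous_on {0..T} (\<lambda>t. z t $ k)" by (rule cz)
        show "1 \<le> z 0 $ k" if "0 \<le> T"
        proof -
          have "z 0 = x" using path that unfolding reflected_path_def by auto
          then show ?thesis using x n by auto
        qed
        fix t assume t: "t \<in> {0..T}" and pos: "\<forall>s\<in>{0..t}. 0 < z s $ k"
        have y0: "y s $ k = 0" if "s \<in> {0..t}" for s
          using that t pos by (auto intro!: reflected_path_no_push[OF path])
        have zl: "z s $ l = x $ l + v $ l * s + b s $ l + R $ l $ i * (y s $ i - u $ i * s) + R $ l $ j * (y s $ j - u $ j * s)"
          if "s \<in> {0..t}" for s l
          using z[of s l] y0[OF that] that t \<theta>[of l] by (auto simp: mult_vec_3[OF ijk] algebra_simps)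
        define e where "e = \<epsilon> * (n + t)"
        have be: "\<bar>b s $ l\<bar> \<le> e" if "s \<in> {0..t}" for s l
        proof -
          have "\<epsilon> * (n + s) \<le> e" unfolding e_def using that \<epsilon>(1) by auto
          then show ?thesis using bnd[of s l] that t by auto
        qed
        have tt: "t \<in> {0..t}" and t0: "0 \<le> t" using t by auto
        have last: "\<exists>s\<in>{0..r}. z s $ l = 0 \<and> y r $ l - u $ l * r \<le> y s $ l - u $ l * s"
          if r: "r \<in> {0..t}" and l: "x $ l = 0" "0 \<le> u $ l" for r l
        proof -
          have "r \<in> {0..T}" using r t by auto
          then obtain s where s: "s \<in> {0..r}" "z s $ l = 0" "y r $ l = y s $ l"
            using reflected_path_last_zero[OF path l(1)] by blast
          then show ?thesis using l(2) by (intro bexI[of _ s]) (auto intro: mult_left_mono)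
        qed
        have "\<bar>y t $ i - u $ i * t\<bar> \<le> C * e \<and> \<bar>y t $ j - u $ j * t\<bar> \<le> C * e"
        unfolding C_def
        proof (rule planar_reflection_bound[OF det, where \<zeta> = "\<lambda>s. z s $ i" and \<zeta>' = "\<lambda>s. z s $ j" and \<beta> = "\<lambda>s. b s $ i" and \<beta>' = "\<lambda>s. b s $ j"
            and \<eta> = "\<lambda>s. y s $ i - u $ i * s" and \<eta>' = "\<lambda>s. y s $ j - u $ j * s"])
          show "continuous_on {0..t} (\<lambda>s. z s $ i)" "continuous_on {0..t} (\<lambda>s. z s $ j)"
            using t by (auto intro!: continuous_on_subset[OF cz])
          show "\<exists>s\<in>{0..r}. z s $ i = 0 \<and> y r $ i - u $ i * r \<le> y s $ i - u $ i * s"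
            "\<exists>s\<in>{0..r}. z s $ j = 0 \<and> y r $ j - u $ j * r \<le> y s $ j - u $ j * s" if "r \<in> {0..t}" for r
            using last[OF that] x sgn by blast+
          show "0 \<le> z s $ i" "0 \<le> z s $ j" if "s \<in> {0..t}" for s
            using z0[of s] that t by auto
          show "z s $ i = b s $ i + (y s $ i - u $ i * s) + R $ i $ j * (y s $ j - u $ j * s)"
            "z s $ j = b s $ j + R $ j $ i * (y s $ i - u $ i * s) + (y s $ j - u $ j * s)" if "s \<in> {0..t}" for s
            using zl[OF that, of i] zl[OF that, of j] x v diag by simp_all
        qed (use t0 be in auto)
        then have "\<bar>R $ k $ i * (y t $ i - u $ i * t)\<bar> \<le> \<bar>R $ k $ i\<bar> * (C * e)"
            "\<bar>R $ k $ j * (y t $ j - u $ j * t)\<bar> \<le> \<bar>R $ k $ j\<bar> * (C * e)"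
          unfolding abs_mult by (auto intro: mult_left_mono)
        moreover have "C' * e = e + \<bar>R $ k $ i\<bar> * (C * e) + \<bar>R $ k $ j\<bar> * (C * e)"
          unfolding C'_def by (simp add: algebra_simps)
        ultimately have "n + v $ k * t - C' * e \<le> z t $ k"
          using zl[OF tt, of k] be[OF tt, of k] x by linarith
        then show "1 \<le> z t $ k" using \<epsilon>(2)[OF n t0] unfolding e_def by linarith
      qed
      then show ?thesis by auto
    qed
    then show "\<exists>x\<in>nonneg_orthant. \<forall>T b y z. reflected_path \<theta> R x T b y z \<and> confined_noise 0 \<epsilon> n T b \<longrightarrow>
        (\<forall>t\<in>{0..T}. \<exists>l. 1 \<le> z t $ l)"
      using xin by blast
  qed
qed

section \<open>Divergent solutions of the linear complementarity problem\<close>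

text \<open>
  With both off-diagonal entries negative, a positive image of a nonnegative vector would force
  the product of the entries below \<open>1\<close>.
\<close>

lemma completely_S_pairD:
  fixes R :: "real ^ 'n ^ 'n"
  assumes S: "completely_S R" and diag: "\<forall>l. R $ l $ l = 1" and ij: "i \<noteq> j" and det: "1 \<le> R $ i $ j * R $ j $ i"
  shows "0 < R $ i $ j" "0 < R $ j $ i"
proof -
  obtain w where w: "\<forall>l\<in>{i,j}. 0 \<le> w l" "\<forall>k\<in>{i,j}. 0 < (\<Sum>l\<in>{i,j}. R $ k $ l * w l)"
    using S unfolding completely_S_def by (metis insert_not_empty)
  then have w: "0 \<le> w i" "0 \<le> w j" "0 < w i + R $ i $ j * w j" "0 < R $ j $ i * w i + w j"
    using ij diag by auto
  have "\<not> (R $ i $ j < 0 \<and> R $ j $ i < 0)"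
  proof
    assume neg: "R $ i $ j < 0 \<and> R $ j $ i < 0"
    have "R $ j $ i * (w i + R $ i $ j * w j) < 0" using w neg by (auto intro: mult_neg_pos)
    then have "R $ j $ i * w i + w j < w j - (R $ i $ j * R $ j $ i) * w j" by (simp add: algebra_simps)
    moreover have "w j \<le> (R $ i $ j * R $ j $ i) * w j" using det w mult_right_mono[of 1 "R $ i $ j * R $ j $ i" "w j"] by simp
    ultimately show False using w by linarith
  qed
  moreover have "0 < R $ i $ j * R $ j $ i" using det by linarith
  ultimately show "0 < R $ i $ j" "0 < R $ j $ i" by (auto simp: zero_less_mult_iff)
qed

text \<open>
  With nonpositive planar determinant a path near the axis \<open>k\<close> may leave it along one of the faces. The
  load \<open>u $ i\<close>, \<open>u $ j\<close> on the two faces can be moved entirely to the face \<open>i\<close>, in the proportion that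
  keeps \<open>v $ i = 0\<close>. This adds \<open>(R $ l $ i * R $ i $ j - R $ l $ j) * u $ j\<close> to \<open>v $ l\<close>, which is
  nonnegative for \<open>l = j\<close> by the sign of the determinant and for \<open>l = k\<close> by the hypothesis \<open>tilt\<close>. The
  new solution, in which \<open>v $ j\<close> may well be \<open>0\<close>, is of the kind with a single pushing face.
\<close>

lemma escape_from_unstable_pair:
  fixes i j k :: 3 and R :: "real ^ 3 ^ 3"
  assumes ijk: "i \<noteq> j" "i \<noteq> k" "j \<noteq> k"
    and diag: "\<forall>l. R $ l $ l = 1"
    and lcp: "lcp_solution \<theta> R u v"
    and v: "v $ i = 0" "v $ j = 0" "0 < v $ k"
    and pos: "0 < R $ i $ j" "0 < R $ j $ i" and det: "1 \<le> R $ i $ j * R $ j $ i"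
    and tilt: "R $ k $ j \<le> R $ k $ i * R $ i $ j"
  shows "escapes_under_confined_noise \<theta> R"
proof -
  have sgn: "0 \<le> u $ i" "0 \<le> u $ j" using lcp unfolding lcp_solution_def by auto
  have "u \<bullet> v = 0" using lcp unfolding lcp_solution_def by blast
  then have "u $ k * v $ k = 0"
    using v by (simp add: inner_vec_def UNIV_3_distinct[OF ijk] ijk)
  then have uk: "u $ k = 0" using v by simp
  have vl: "v $ l = \<theta> $ l + R $ l $ i * u $ i + R $ l $ j * u $ j" for l
    using lcp uk unfolding lcp_solution_def by (auto simp: mult_vec_3[OF ijk])
  define u' :: "real ^ 3" where "u' = (u $ i + R $ i $ j * u $ j) *\<^sub>R axis i 1"
  define v' where "v' = \<theta> + R *v u'"
  have u': "u' $ i = u $ i + R $ i $ j * u $ j" "u' $ j = 0" "u' $ k = 0"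
    unfolding u'_def using ijk by (auto simp: axis_def)
  have v'l: "v' $ l = v $ l + (R $ l $ i * R $ i $ j - R $ l $ j) * u $ j" for l
    unfolding v'_def using vl[of l] u' by (simp add: mult_vec_3[OF ijk] algebra_simps)
  have v': "v' $ i = 0" "0 \<le> v' $ j" "0 < v' $ k"
  proof -
    show "v' $ i = 0" using v'l[of i] v diag by simp
    show "0 \<le> v' $ j" using v'l[of j] v diag det sgn by (simp add: mult.commute)
    have "0 \<le> (R $ k $ i * R $ i $ j - R $ k $ j) * u $ j" using tilt sgn by simp
    then show "0 < v' $ k" using v'l[of k] v by simp
  qed
  have all: "(\<forall>l. Q l) \<longleftrightarrow> Q i \<and> Q j \<and> Q k" for Q :: "3 \<Rightarrow> bool"
  proof -
    have "(\<forall>l. Q l) \<longleftrightarrow> (\<forall>l\<in>UNIV. Q l)" by simp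
    then show ?thesis unfolding UNIV_3_distinct[OF ijk] by simp
  qed
  have "lcp_solution \<theta> R u' v'"
    unfolding lcp_solution_def all using u' v' sgn pos v'_def
    by (auto simp: inner_vec_def UNIV_3_distinct[OF ijk] ijk)
  then show ?thesis
    by (rule escape_along_two_axes[OF ijk diag]) (use u' v' pos in auto)
qed

text \<open>
  Fix \<open>k\<close> with \<open>v $ k > 0\<close>. All configurations are covered by the preceding lemmas as soon as, for
  nonpositive planar determinant, one of the two ways of moving the load to a single face does not
  tilt the path against the axis \<open>k\<close>. If both did, the cofactors \<open>(ci, cj, ck)\<close> belonging to the column
  \<open>k\<close> of \<open>R\<close> (with their signs reversed) would all be positive. They annihilate the columns \<open>i\<close> and \<open>j\<close>
  and pair with the column \<open>k\<close> to a number \<open>e\<close>. Pairing them with \<open>\<theta> = v - R *v u\<close> gives a positive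
  number, pairing them with \<open>\<theta> = - R *v y\<close> gives \<open>- e * y $ k\<close>, so \<open>e < 0\<close>; but pairing them with a
  positive image \<open>R *v w\<close> of a nonnegative \<open>w\<close> shows \<open>e > 0\<close>.
\<close>

lemma escape_of_divergent_lcp:
  fixes R :: "real ^ 3 ^ 3"
  assumes S: "completely_S R" and diag: "\<forall>l. R $ l $ l = 1"
    and y: "R *v y = - \<theta>" "\<forall>l. 0 < y $ l"
    and div: "divergent_lcp_solution \<theta> R u v"
  shows "escapes_under_confined_noise \<theta> R"
proof -
  have lcp: "lcp_solution \<theta> R u v" and "v \<noteq> 0" using div unfolding divergent_lcp_solution_def by auto
  have nn: "0 \<le> u $ l" "0 \<le> v $ l" for l using lcp unfolding lcp_solution_def by auto
  have "u $ l * v $ l = 0" for l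
  proof -
    have "u \<bullet> v = 0" using lcp unfolding lcp_solution_def by blast
    then have "(\<Sum>l\<in>UNIV. u $ l * v $ l) = 0" by (simp add: inner_vec_def)
    then show ?thesis using nn by (subst (asm) sum_nonneg_eq_0_iff) auto
  qed
  then have u0: "u $ l = 0" if "0 < v $ l" for l using that by (metis mult_eq_0_iff order_less_irrefl)
  obtain k where "v $ k \<noteq> 0" using \<open>v \<noteq> 0\<close> by (auto simp: vec_eq_iff)
  then have k: "0 < v $ k" using nn(2)[of k] by simp
  show ?thesis
  proof (cases "\<exists>j. j \<noteq> k \<and> 0 < v $ j")
    case True
    then obtain j where j: "j \<noteq> k" "0 < v $ j" by auto
    have "card {j, k} < CARD(3)" using j by simp
    then have "{j, k} \<noteq> UNIV" by (metis less_irrefl)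
    then obtain i where i: "i \<noteq> j" "i \<noteq> k" by blast
    show ?thesis using escape_along_two_axes[OF i j(1) diag lcp] u0 j k by auto
  next
    case False
    then have v0: "v $ l = 0" if "l \<noteq> k" for l using nn(2)[of l] that by (metis order_le_less)
    have "card {k} < CARD(3)" by simp
    then have "{k} \<noteq> UNIV" by (metis less_irrefl)
    then obtain i where i: "i \<noteq> k" by blast
    have "card {i, k} < CARD(3)" using i by simp
    then have "{i, k} \<noteq> UNIV" by (metis less_irrefl)
    then obtain j where j: "j \<noteq> i" "j \<noteq> k" by blast
    have ijk: "i \<noteq> j" "i \<noteq> k" "j \<noteq> k" and jik: "j \<noteq> i" "j \<noteq> k" "i \<noteq> k" using i j by auto
    show ?thesis
    proof (cases "R $ i $ j * R $ j $ i < 1")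
      case True
      show ?thesis by (rule escape_along_one_axis[OF ijk diag lcp]) (use v0 k ijk True in auto)
    next
      case F: False
      then have det: "1 \<le> R $ i $ j * R $ j $ i" by simp
      note pos = completely_S_pairD[OF S diag ijk(1) det]
      define ci where "ci = R $ k $ i - R $ j $ i * R $ k $ j"
      define cj where "cj = R $ k $ j - R $ i $ j * R $ k $ i"
      define ck where "ck = R $ i $ j * R $ j $ i - 1"
      have "cj \<le> 0 \<or> ci \<le> 0"
      proof (rule ccontr)
        assume "\<not> ?thesis"
        then have c: "0 < ci" "0 < cj" by auto
        have "ci + R $ j $ i * cj = - ck * R $ k $ i"
          unfolding ci_def cj_def ck_def by (simp add: algebra_simps)
        moreover have "0 < ci + R $ j $ i * cj" using c pos by (auto intro: add_pos_pos)
        ultimately have "ck \<noteq> 0" by auto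
        then have ck: "0 < ck" using det unfolding ck_def by auto
        define e where "e = ci * R $ i $ k + cj * R $ j $ k + ck"
        have cR: "ci * (R *v w) $ i + cj * (R *v w) $ j + ck * (R *v w) $ k = e * w $ k" for w
          unfolding e_def ci_def cj_def ck_def using diag
          by (simp add: mult_vec_3[OF ijk] algebra_simps)
        have "u $ k = 0" using u0[OF k] .
        have v: "v = \<theta> + R *v u" using lcp unfolding lcp_solution_def by auto
        have "ci * v $ i + cj * v $ j + ck * v $ k = (ci * \<theta> $ i + cj * \<theta> $ j + ck * \<theta> $ k) + e * u $ k"
          unfolding v using cR[of u] by (simp add: algebra_simps)
        moreover have "ci * \<theta> $ i + cj * \<theta> $ j + ck * \<theta> $ k = - e * y $ k"
          using cR[of y] y(1) by simp
        ultimately have "ck * v $ k = - e * y $ k" using v0 ijk \<open>u $ k = 0\<close> by auto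
        moreover have "0 < ck * v $ k" using ck k by simp
        ultimately have "0 < (- e) * y $ k" by simp
        then have "e < 0" using spec[OF y(2), of k] by (simp only: zero_less_mult_iff) linarith
        obtain w where w: "\<forall>l. 0 \<le> w l" "\<forall>i. 0 < (\<Sum>l\<in>UNIV. R $ i $ l * w l)"
          using S unfolding completely_S_def by (metis UNIV_I UNIV_not_empty)
        define w' :: "real ^ 3" where "w' = (\<chi> l. w l)"
        have "0 < (R *v w') $ l" for l using w(2) unfolding w'_def matrix_vector_mult_def by simp
        then have "0 < ci * (R *v w') $ i + cj * (R *v w') $ j + ck * (R *v w') $ k"
          using c ck by (auto intro!: add_pos_pos)
        moreover have "0 \<le> w' $ k" using w unfolding w'_def by simp
        ultimately show False using cR[of w'] \<open>e < 0\<close> by (simp add: zero_less_mult_iff)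
      qed
      then show ?thesis
      proof
        assume "cj \<le> 0"
        then show ?thesis unfolding cj_def
          by (intro escape_from_unstable_pair[OF ijk diag lcp]) (use v0 k ijk pos det in \<open>auto simp: mult.commute\<close>)
      next
        assume "ci \<le> 0"
        then show ?thesis unfolding ci_def
          by (intro escape_from_unstable_pair[OF jik diag lcp]) (use v0 k ijk pos det in \<open>auto simp: mult.commute\<close>)
      qed
    qed
  qed
qed

section \<open>Stopping inequalities in discrete time\<close>

text \<open>
  The sum of fourth powers serves as a convex gauge of the size of the noise. The second moment would
  not do: the envelope grows linearly, and the bound on the expected overshoot at the exit from it
  would then be a divergent integral over time, while the fourth moment leaves \<open>t / (n + t) ^ 3\<close>.
\<close>

definition quartic :: "real ^ 'n \<Rightarrow> real" where
  "quartic y = (\<Sum>l\<in>UNIV. (y $ l) ^ 4)"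

lemma quartic_nonneg: "0 \<le> quartic y"
  unfolding quartic_def by (intro sum_nonneg) simp

lemma quartic_zero [simp]: "quartic 0 = 0"
  unfolding quartic_def by simp

lemma fourth_power_component_le: "(y $ l) ^ 4 \<le> quartic y"
  unfolding quartic_def by (rule member_le_sum) auto

lemma quartic_scaleR: "quartic (c *\<^sub>R y) = c ^ 4 * quartic y"
  unfolding quartic_def by (simp add: power_mult_distrib sum_distrib_left)

lemma continuous_on_quartic [continuous_intros]:
  "continuous_on S f \<Longrightarrow> continuous_on S (\<lambda>t. quartic (f t))"
  unfolding quartic_def by (intro continuous_intros)

lemma borel_measurable_quartic [measurable]: "quartic \<in> borel_measurable borel"
  by (rule borel_measurable_continuous_onI) (intro continuous_intros)

lemma borel_measurable_vec_nth_comp: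
  fixes f :: "'w \<Rightarrow> real ^ 'n"
  assumes "f \<in> borel_measurable M"
  shows "(\<lambda>\<omega>. f \<omega> $ l) \<in> borel_measurable M"
proof -
  have "(\<lambda>\<omega>. f \<omega> \<bullet> axis l 1) \<in> borel_measurable M" using assms by measurable
  then show ?thesis by (simp add: inner_axis)
qed

lemma quartic_le_component:
  assumes "quartic y \<le> r ^ 4" "0 \<le> r"
  shows "\<bar>y $ l\<bar> \<le> r"
proof -
  have "\<bar>y $ l\<bar> ^ 4 \<le> r ^ 4" using fourth_power_component_le[of y l] assms by (simp add: power_even_abs)
  then show ?thesis using assms(2) power_mono_iff[of "\<bar>y $ l\<bar>" r 4] by simp
qed

text \<open>
  Outside the ball of radius \<open>r\<close> of the gauge, a linear functional is dominated by the gauge divided by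
  \<open>r ^ 3\<close>. This is what turns the weighted maximal inequality into a bound on the overshoot.
\<close>

lemma component_le_quartic:
  assumes "r ^ 4 < quartic y" "0 \<le> r"
  shows "\<bar>y $ l\<bar> * r ^ 3 \<le> quartic y"
proof (cases "\<bar>y $ l\<bar> \<le> r")
  case True
  then have "\<bar>y $ l\<bar> * r ^ 3 \<le> r * r ^ 3" using assms by (intro mult_right_mono) auto
  then show ?thesis using assms by (simp add: power_numeral_reduce)
next
  case False
  then have "\<bar>y $ l\<bar> * r ^ 3 \<le> \<bar>y $ l\<bar> * \<bar>y $ l\<bar> ^ 3" using assms by (intro mult_left_mono power_mono) auto
  also have "\<dots> = (y $ l) ^ 4" by (simp add: power_numeral_reduce)
  finally show ?thesis using fourth_power_component_le[of y l] by linarith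
qed

definition l1_norm :: "real ^ 'n \<Rightarrow> real" where
  "l1_norm a = (\<Sum>l\<in>UNIV. \<bar>a $ l\<bar>)"

lemma l1_norm_nonneg: "0 \<le> l1_norm a"
  unfolding l1_norm_def by (intro sum_nonneg) simp

lemma abs_inner_le_l1_norm:
  assumes "\<And>l. \<bar>y $ l\<bar> \<le> r"
  shows "\<bar>a \<bullet> y\<bar> \<le> l1_norm a * r"
proof -
  have "\<bar>a \<bullet> y\<bar> \<le> (\<Sum>l\<in>UNIV. \<bar>a $ l * y $ l\<bar>)" unfolding inner_vec_def by (simp add: sum_abs)
  also have "\<dots> \<le> (\<Sum>l\<in>UNIV. \<bar>a $ l\<bar> * r)"
    unfolding abs_mult using assms by (intro sum_mono mult_left_mono) auto
  finally show ?thesis unfolding l1_norm_def by (simp add: sum_distrib_right)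
qed

text \<open>
  An inequality of Hajek and Renyi. Read \<open>A k\<close> as the event that a stopping rule has not stopped by
  time \<open>k\<close>, so that \<open>A k - A (Suc k)\<close> is stopping at time \<open>Suc k\<close>: the value of the nonnegative
  submartingale \<open>\<phi>\<close> at the stopping time, weighted by decreasing weights \<open>c\<close>, has at most the weighted sum
  of the expected increments as its expectation. The hypothesis \<open>sub\<close> is the submartingale property on
  the complement of \<open>A k\<close>. Summation by parts moves the weights through the induction.
\<close>

lemma weighted_maximal_inequality:
  fixes \<phi> :: "nat \<Rightarrow> 'w \<Rightarrow> real"
  assumes int: "\<And>k. integrable M (\<phi> k)" and nonneg: "\<And>k \<omega>. 0 \<le> \<phi> k \<omega>"
    and A: "\<And>k. A k \<in> sets M" "\<And>k. A (Suc k) \<subseteq> A k"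
    and sub: "\<And>k. (\<integral>\<omega>. indicator (A k) \<omega> * (\<phi> (Suc k) \<omega> - \<phi> k \<omega>) \<partial>M)
                 \<le> (\<integral>\<omega>. \<phi> (Suc k) \<omega> \<partial>M) - (\<integral>\<omega>. \<phi> k \<omega> \<partial>M)"
    and c: "\<And>k. 0 \<le> c k" "\<And>k. c (Suc k) \<le> c k"
  shows "(\<Sum>k<m. c (Suc k) * (\<integral>\<omega>. indicator (A k - A (Suc k)) \<omega> * \<phi> (Suc k) \<omega> \<partial>M))
           + c m * (\<integral>\<omega>. indicator (A m) \<omega> * \<phi> m \<omega> \<partial>M)
         \<le> c 0 * (\<integral>\<omega>. \<phi> 0 \<omega> \<partial>M)
           + (\<Sum>k<m. c (Suc k) * ((\<integral>\<omega>. \<phi> (Suc k) \<omega> \<partial>M) - (\<integral>\<omega>. \<phi> k \<omega> \<partial>M)))"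
proof (induction m)
  case 0
  have "(\<integral>\<omega>. indicator (A 0) \<omega> * \<phi> 0 \<omega> \<partial>M) \<le> (\<integral>\<omega>. \<phi> 0 \<omega> \<partial>M)"
    using integrable_real_mult_indicator[OF A(1)[of 0] int[of 0]] int nonneg
    by (intro integral_mono) (auto simp: mult.commute indicator_def split: if_splits)
  then show ?case using c(1)[of 0] by (simp add: mult_left_mono)
next
  case (Suc m)
  define V where "V k = (\<integral>\<omega>. indicator (A k) \<omega> * \<phi> k \<omega> \<partial>M)" for k
  define U where "U = (\<integral>\<omega>. indicator (A m - A (Suc m)) \<omega> * \<phi> (Suc m) \<omega> \<partial>M)"
  have i: "integrable M (\<lambda>\<omega>. indicator B \<omega> * \<phi> k \<omega>)" if "B \<in> sets M" for B k
    using integrable_real_mult_indicator[OF that int[of k]] by (simp add: mult.commute)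
  have V0: "0 \<le> V k" for k unfolding V_def using nonneg by (intro integral_nonneg_AE) (auto simp: indicator_def)
  have "(\<integral>\<omega>. indicator (A m) \<omega> * \<phi> (Suc m) \<omega> \<partial>M) = U + V (Suc m)"
  proof -
    have "U + V (Suc m) = (\<integral>\<omega>. indicator (A m - A (Suc m)) \<omega> * \<phi> (Suc m) \<omega> + indicator (A (Suc m)) \<omega> * \<phi> (Suc m) \<omega> \<partial>M)"
      unfolding U_def V_def using A by (subst Bochner_Integration.integral_add) (auto intro!: i)
    also have "\<dots> = (\<integral>\<omega>. indicator (A m) \<omega> * \<phi> (Suc m) \<omega> \<partial>M)"
      using A(2)[of m] by (intro Bochner_Integration.integral_cong) (auto simp: indicator_def)
    finally show ?thesis by simp
  qed
  moreover have "(\<integral>\<omega>. indicator (A m) \<omega> * (\<phi> (Suc m) \<omega> - \<phi> m \<omega>) \<partial>M)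
      = (\<integral>\<omega>. indicator (A m) \<omega> * \<phi> (Suc m) \<omega> \<partial>M) - V m"
    unfolding V_def right_diff_distrib using A by (subst Bochner_Integration.integral_diff) (auto intro!: i)
  ultimately have "U + V (Suc m) \<le> V m + ((\<integral>\<omega>. \<phi> (Suc m) \<omega> \<partial>M) - (\<integral>\<omega>. \<phi> m \<omega> \<partial>M))"
    using sub[of m] by linarith
  then have "c (Suc m) * (U + V (Suc m)) \<le> c (Suc m) * (V m + ((\<integral>\<omega>. \<phi> (Suc m) \<omega> \<partial>M) - (\<integral>\<omega>. \<phi> m \<omega> \<partial>M)))"
    using c(1) by (intro mult_left_mono)
  moreover have "c (Suc m) * V m \<le> c m * V m" using c V0 by (intro mult_right_mono)
  ultimately show ?case
    using Suc.IH unfolding sum.lessThan_Suc V_def[symmetric] U_def[symmetric] distrib_left by linarith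
qed

text \<open>
  Optional stopping at a bounded time, with the expectation split according to the time of stopping.
\<close>

lemma optional_stopping_decomposition:
  fixes \<psi> :: "nat \<Rightarrow> 'w \<Rightarrow> real"
  assumes int: "\<And>k. integrable M (\<psi> k)"
    and A: "\<And>k. A k \<in> sets M" "\<And>k. A (Suc k) \<subseteq> A k"
    and mart: "\<And>k. (\<integral>\<omega>. indicator (A k) \<omega> * \<psi> (Suc k) \<omega> \<partial>M) = (\<integral>\<omega>. indicator (A k) \<omega> * \<psi> k \<omega> \<partial>M)"
  shows "(\<integral>\<omega>. indicator (A m) \<omega> * \<psi> m \<omega> \<partial>M)
           + (\<Sum>k<m. \<integral>\<omega>. indicator (A k - A (Suc k)) \<omega> * \<psi> (Suc k) \<omega> \<partial>M)
         = (\<integral>\<omega>. indicator (A 0) \<omega> * \<psi> 0 \<omega> \<partial>M)"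
proof (induction m)
  case (Suc m)
  have i: "integrable M (\<lambda>\<omega>. indicator B \<omega> * \<psi> k \<omega>)" if "B \<in> sets M" for B k
    using integrable_real_mult_indicator[OF that int[of k]] by (simp add: mult.commute)
  have "(\<integral>\<omega>. indicator (A m - A (Suc m)) \<omega> * \<psi> (Suc m) \<omega> \<partial>M) + (\<integral>\<omega>. indicator (A (Suc m)) \<omega> * \<psi> (Suc m) \<omega> \<partial>M)
      = (\<integral>\<omega>. indicator (A m - A (Suc m)) \<omega> * \<psi> (Suc m) \<omega> + indicator (A (Suc m)) \<omega> * \<psi> (Suc m) \<omega> \<partial>M)"
    using A by (subst Bochner_Integration.integral_add) (auto intro!: i)
  also have "\<dots> = (\<integral>\<omega>. indicator (A m) \<omega> * \<psi> (Suc m) \<omega> \<partial>M)"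
    using A(2)[of m] by (intro Bochner_Integration.integral_cong) (auto simp: indicator_def)
  finally show ?case using Suc.IH mart[of m] by simp
qed simp

text \<open>
  The right-hand side is the increment of a primitive of \<open>2 * t / (n + t) ^ 3\<close>, and \<open>1 / (n + t) ^ 3\<close>
  decreases. This form telescopes over any time grid, with the total bounded by \<open>1 / n\<close>.
\<close>

lemma sum_of_squares_increments_bound:
  fixes s t n :: real
  assumes "0 \<le> s" "s \<le> t" "0 < n"
  shows "(t\<^sup>2 - s\<^sup>2) / (n + t) ^ 3 \<le> (t\<^sup>2 / (n + t)\<^sup>2 - s\<^sup>2 / (n + s)\<^sup>2) / n"
proof -
  define X where "X = n * (t + s) + 2 * t * s"
  have nz: "n + t \<noteq> 0" "n + s \<noteq> 0" "n \<noteq> 0" using assms by auto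
  have "X * (n + t) - (t + s) * (n + s)\<^sup>2 = n * ((t - s) * (t + 2 * s)) + s * ((t - s) * (2 * t + s))"
    unfolding X_def by (simp add: power2_eq_square algebra_simps)
  moreover have "0 \<le> n * ((t - s) * (t + 2 * s))" "0 \<le> s * ((t - s) * (2 * t + s))" using assms by auto
  ultimately have "(t + s) * (n + s)\<^sup>2 \<le> X * (n + t)" by linarith
  then have "(t - s) * ((t + s) * (n + s)\<^sup>2) / ((n + t) ^ 3 * (n + s)\<^sup>2)
      \<le> (t - s) * (X * (n + t)) / ((n + t) ^ 3 * (n + s)\<^sup>2)"
    using assms by (intro divide_right_mono mult_left_mono) auto
  moreover have "(t - s) * ((t + s) * (n + s)\<^sup>2) / ((n + t) ^ 3 * (n + s)\<^sup>2) = (t\<^sup>2 - s\<^sup>2) / (n + t) ^ 3"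
  proof -
    have "(t - s) * ((t + s) * (n + s)\<^sup>2) / ((n + t) ^ 3 * (n + s)\<^sup>2) = ((t - s) * (t + s)) / (n + t) ^ 3"
      using nz by simp
    also have "(t - s) * (t + s) = t\<^sup>2 - s\<^sup>2" by (simp add: power2_eq_square algebra_simps)
    finally show ?thesis .
  qed
  moreover have "(t - s) * (X * (n + t)) / ((n + t) ^ 3 * (n + s)\<^sup>2) = (t\<^sup>2 / (n + t)\<^sup>2 - s\<^sup>2 / (n + s)\<^sup>2) / n"
  proof -
    have "(t - s) * X = (t\<^sup>2 * (n + s)\<^sup>2 - s\<^sup>2 * (n + t)\<^sup>2) / n"
      unfolding X_def using nz by (simp add: power2_eq_square field_simps)
    moreover have "(t - s) * (X * (n + t)) / ((n + t) ^ 3 * (n + s)\<^sup>2) = (t - s) * X / ((n + t)\<^sup>2 * (n + s)\<^sup>2)"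
      using nz by (simp add: power3_eq_cube power2_eq_square)
    moreover have "(t\<^sup>2 * (n + s)\<^sup>2 - s\<^sup>2 * (n + t)\<^sup>2) / n / ((n + t)\<^sup>2 * (n + s)\<^sup>2) = (t\<^sup>2 / (n + t)\<^sup>2 - s\<^sup>2 / (n + s)\<^sup>2) / n"
      using nz by (simp add: diff_divide_distrib mult.commute)
    ultimately show ?thesis by simp
  qed
  ultimately show ?thesis by simp
qed

section \<open>Martingales with quadratically growing fourth moments\<close>

lemma fourth_power_convex: "4 * p ^ 3 * (q - p) \<le> q ^ 4 - p ^ 4" for p q :: real
proof -
  have "q ^ 4 - p ^ 4 - 4 * p ^ 3 * (q - p) = (q - p)\<^sup>2 * ((q + p)\<^sup>2 + 2 * p\<^sup>2)"
    by (simp add: power2_eq_square power3_eq_cube power_numeral_reduce algebra_simps)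
  moreover have "0 \<le> (q - p)\<^sup>2 * ((q + p)\<^sup>2 + 2 * p\<^sup>2)" by simp
  ultimately show ?thesis by linarith
qed

lemma cubic_times_linear_le: "\<bar>p ^ 3 * q\<bar> \<le> p ^ 4 + q ^ 4" for p q :: real
proof -
  have 4: "\<bar>r\<bar> ^ 3 * \<bar>r\<bar> = r ^ 4" for r :: real
  proof -
    have "\<bar>r\<bar> ^ 3 * \<bar>r\<bar> = \<bar>r\<bar> ^ 4" by (simp only: power3_eq_cube power4_eq_xxxx mult.assoc)
    then show ?thesis by (simp add: power_even_abs)
  qed
  have nn: "0 \<le> p ^ 4" "0 \<le> q ^ 4" by simp_all
  have "\<bar>p\<bar> ^ 3 * \<bar>q\<bar> \<le> p ^ 4 + q ^ 4"
  proof (cases "\<bar>q\<bar> \<le> \<bar>p\<bar>")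
    case True
    then have "\<bar>p\<bar> ^ 3 * \<bar>q\<bar> \<le> \<bar>p\<bar> ^ 3 * \<bar>p\<bar>" by (intro mult_left_mono) auto
    then show ?thesis using 4[of p] nn by linarith
  next
    case False
    then have "\<bar>p\<bar> ^ 3 * \<bar>q\<bar> \<le> \<bar>q\<bar> ^ 3 * \<bar>q\<bar>" by (intro mult_right_mono power_mono) auto
    then show ?thesis using 4[of q] nn by linarith
  qed
  then show ?thesis by (simp add: abs_mult power_abs)
qed

text \<open>
  The two features of Brownian motion that the estimates rest on: it is a martingale, and its fourth
  moments grow like \<open>t\<^sup>2\<close>.
\<close>

locale quartic_martingale = prob_space Q for Q :: "'w measure" +
  fixes F :: "real \<Rightarrow> 'w measure" and W :: "real \<Rightarrow> 'w \<Rightarrow> real ^ 'n" and x :: "real ^ 'n" and C :: real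
  assumes filtration: "filtered_space Q F"
    and martingale: "martingale Q F W"
    and start: "AE \<omega> in Q. W 0 \<omega> = x"
    and quartic_integrable: "\<And>t. 0 \<le> t \<Longrightarrow> integrable Q (\<lambda>\<omega>. quartic (W t \<omega> - x))"
    and quartic_integral: "\<And>t. 0 \<le> t \<Longrightarrow> (\<integral>\<omega>. quartic (W t \<omega> - x) \<partial>Q) = C * t\<^sup>2"
begin

definition B :: "real \<Rightarrow> 'w \<Rightarrow> real ^ 'n" where "B t \<omega> = W t \<omega> - x"

lemma sub: "0 \<le> t \<Longrightarrow> subalgebra Q (F t)" "0 \<le> s \<Longrightarrow> s \<le> t \<Longrightarrow> subalgebra (F t) (F s)"
  using filtration unfolding filtered_space_def by auto

lemma B_measurable_F: "0 \<le> s \<Longrightarrow> s \<le> t \<Longrightarrow> B s \<in> borel_measurable (F t)"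
proof -
  assume st: "0 \<le> s" "s \<le> t"
  then have "W s \<in> borel_measurable (F s)" using martingale unfolding martingale_def adapted_def by auto
  then have "W s \<in> borel_measurable (F t)" using measurable_from_subalg[OF sub(2)[OF st]] by auto
  then show "B s \<in> borel_measurable (F t)" unfolding B_def[abs_def] by simp
qed

lemma B_measurable: "0 \<le> t \<Longrightarrow> B t \<in> borel_measurable Q"
  using measurable_from_subalg[OF sub(1)] B_measurable_F[of t t] by auto

lemma B_integrable: "0 \<le> t \<Longrightarrow> integrable Q (\<lambda>\<omega>. B t \<omega> $ l)"
proof -
  assume "0 \<le> t"
  then have "integrable Q (W t)" using martingale unfolding martingale_def by auto
  then have "integrable Q (B t)" unfolding B_def[abs_def] by auto
  then have "integrable Q (\<lambda>\<omega>. B t \<omega> \<bullet> axis l 1)" by simp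
  then show ?thesis by (simp add: inner_axis)
qed

text \<open>
  Increments of the martingale are orthogonal to everything known at time \<open>s\<close>.
\<close>

lemma martingale_pairing:
  assumes st: "0 \<le> s" "s \<le> t" and g: "g \<in> borel_measurable (F s)" "integrable Q g"
    and int: "integrable Q (\<lambda>\<omega>. g \<omega> * B t \<omega> $ l)"
  shows "(\<integral>\<omega>. g \<omega> * B t \<omega> $ l \<partial>Q) = (\<integral>\<omega>. g \<omega> * B s \<omega> $ l \<partial>Q)"
proof -
  have t0: "0 \<le> t" using st by simp
  interpret S: finite_measure_subalgebra Q "F s"
    using sub(1)[OF st(1)] finite_measure_axioms by (simp add: finite_measure_subalgebra_def finite_measure_subalgebra_axioms_def)
  have gQ: "g \<in> borel_measurable Q" using measurable_from_subalg[OF sub(1)[OF st(1)] g(1)] .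
  have WB: "W r \<omega> $ l = B r \<omega> $ l + x $ l" for r \<omega> unfolding B_def by simp
  have intW: "integrable Q (\<lambda>\<omega>. g \<omega> * W t \<omega> $ l)"
    unfolding WB distrib_left using int g(2) by auto
  have Wm: "(\<lambda>\<omega>. W r \<omega> $ l) \<in> borel_measurable Q" if "0 \<le> r" for r
    unfolding WB using borel_measurable_vec_nth_comp[OF B_measurable[OF that]] by simp
  have ae: "AE \<omega> in Q. real_cond_exp Q (F s) (\<lambda>\<omega>. W t \<omega> $ l) \<omega> = W s \<omega> $ l"
    using martingale st unfolding martingale_def by auto
  note ce = S.real_cond_exp_intg[OF intW g(1) Wm[OF t0]]
  have ae': "AE \<omega> in Q. g \<omega> * real_cond_exp Q (F s) (\<lambda>\<omega>. W t \<omega> $ l) \<omega> = g \<omega> * W s \<omega> $ l"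
    using ae by auto
  have intWs: "integrable Q (\<lambda>\<omega>. g \<omega> * W s \<omega> $ l)"
    using ce(1) ae' gQ Wm[OF st(1)] by (subst integrable_cong_AE[symmetric, OF _ _ ae']) auto
  have eqW: "(\<integral>\<omega>. g \<omega> * W t \<omega> $ l \<partial>Q) = (\<integral>\<omega>. g \<omega> * W s \<omega> $ l \<partial>Q)"
    unfolding ce(2)[symmetric] using ae' gQ Wm[OF st(1)] by (intro integral_cong_AE) auto
  have Beq: "g \<omega> * B r \<omega> $ l = g \<omega> * W r \<omega> $ l - g \<omega> * x $ l" for r \<omega>
    unfolding WB by (simp add: algebra_simps)
  have "(\<integral>\<omega>. g \<omega> * B r \<omega> $ l \<partial>Q) = (\<integral>\<omega>. g \<omega> * W r \<omega> $ l \<partial>Q) - (\<integral>\<omega>. g \<omega> * x $ l \<partial>Q)"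
    if "integrable Q (\<lambda>\<omega>. g \<omega> * W r \<omega> $ l)" for r
    unfolding Beq using that g(2) by (intro Bochner_Integration.integral_diff) auto
  then show ?thesis using intW intWs eqW by simp
qed

text \<open>
  By convexity the increment of the gauge dominates its gradient at time \<open>s\<close> paired with the increment
  of the martingale, which has mean zero even after restriction to an event known at time \<open>s\<close>.
\<close>

lemma quartic_submartingale:
  assumes st: "0 \<le> s" "s \<le> t" and A: "A \<in> sets (F s)"
  shows "0 \<le> (\<integral>\<omega>. indicator A \<omega> * (quartic (B t \<omega>) - quartic (B s \<omega>)) \<partial>Q)"
proof -
  have t0: "0 \<le> t" using st by simp
  have AQ: "A \<in> sets Q" using A sub(1)[OF st(1)] unfolding subalgebra_def by auto
  define g where "g l \<omega> = indicator A \<omega> * (B s \<omega> $ l) ^ 3" for l \<omega>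
  have qi: "integrable Q (\<lambda>\<omega>. quartic (B r \<omega>))" if "0 \<le> r" for r
    using quartic_integrable[OF that] unfolding B_def .
  have gF: "g l \<in> borel_measurable (F s)" for l
    unfolding g_def[abs_def] using A borel_measurable_vec_nth_comp[OF B_measurable_F[OF st(1) order_refl]] by measurable
  have gQ: "g l \<in> borel_measurable Q" for l using measurable_from_subalg[OF sub(1)[OF st(1)] gF] .
  have gi: "integrable Q (g l)" for l
  proof (rule Bochner_Integration.integrable_bound)
    show "integrable Q (\<lambda>\<omega>. quartic (B s \<omega>) + 1)" using qi[OF st(1)] by auto
    show "AE \<omega> in Q. norm (g l \<omega>) \<le> norm (quartic (B s \<omega>) + 1)"
    proof (intro AE_I2)
      fix \<omega>
      have "\<bar>g l \<omega>\<bar> \<le> \<bar>(B s \<omega> $ l) ^ 3 * 1\<bar>" unfolding g_def by (auto simp: indicator_def)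
      also have "\<dots> \<le> (B s \<omega> $ l) ^ 4 + 1 ^ 4" by (rule cubic_times_linear_le)
      finally show "norm (g l \<omega>) \<le> norm (quartic (B s \<omega>) + 1)"
        using fourth_power_component_le[of "B s \<omega>" l] quartic_nonneg[of "B s \<omega>"] by simp
    qed
  qed (rule gQ)
  have gBi: "integrable Q (\<lambda>\<omega>. g l \<omega> * B r \<omega> $ l)" if r: "0 \<le> r" for l r
  proof (rule Bochner_Integration.integrable_bound)
    show "integrable Q (\<lambda>\<omega>. quartic (B s \<omega>) + quartic (B r \<omega>))" using qi[OF st(1)] qi[OF r] by auto
    show "(\<lambda>\<omega>. g l \<omega> * B r \<omega> $ l) \<in> borel_measurable Q" using gQ borel_measurable_vec_nth_comp[OF B_measurable[OF r]] by measurable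
    show "AE \<omega> in Q. norm (g l \<omega> * B r \<omega> $ l) \<le> norm (quartic (B s \<omega>) + quartic (B r \<omega>))"
    proof (intro AE_I2)
      fix \<omega>
      have "\<bar>g l \<omega> * B r \<omega> $ l\<bar> \<le> \<bar>(B s \<omega> $ l) ^ 3 * B r \<omega> $ l\<bar>" unfolding g_def by (auto simp: indicator_def)
      also have "\<dots> \<le> (B s \<omega> $ l) ^ 4 + (B r \<omega> $ l) ^ 4" by (rule cubic_times_linear_le)
      finally show "norm (g l \<omega> * B r \<omega> $ l) \<le> norm (quartic (B s \<omega>) + quartic (B r \<omega>))"
        using fourth_power_component_le[of "B s \<omega>" l] quartic_nonneg[of "B s \<omega>"]
          fourth_power_component_le[of "B r \<omega>" l] quartic_nonneg[of "B r \<omega>"] by simp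
    qed
  qed
  have "0 = (\<Sum>l\<in>UNIV. 4 * ((\<integral>\<omega>. g l \<omega> * B t \<omega> $ l \<partial>Q) - (\<integral>\<omega>. g l \<omega> * B s \<omega> $ l \<partial>Q)))"
    using martingale_pairing[OF st gF gi gBi[OF t0]] by simp
  also have "\<dots> = (\<integral>\<omega>. (\<Sum>l\<in>UNIV. 4 * (g l \<omega> * B t \<omega> $ l - g l \<omega> * B s \<omega> $ l)) \<partial>Q)"
    using gBi[OF t0] gBi[OF st(1)] by simp
  also have "\<dots> \<le> (\<integral>\<omega>. indicator A \<omega> * (quartic (B t \<omega>) - quartic (B s \<omega>)) \<partial>Q)"
  proof (rule integral_mono)
    show "integrable Q (\<lambda>\<omega>. \<Sum>l\<in>UNIV. 4 * (g l \<omega> * B t \<omega> $ l - g l \<omega> * B s \<omega> $ l))"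
      using gBi[OF t0] gBi[OF st(1)] by auto
    show "integrable Q (\<lambda>\<omega>. indicator A \<omega> * (quartic (B t \<omega>) - quartic (B s \<omega>)))"
      using integrable_real_mult_indicator[OF AQ Bochner_Integration.integrable_diff[OF qi[OF t0] qi[OF st(1)]]]
      by (simp add: mult.commute)
    fix \<omega>
    have "(\<Sum>l\<in>UNIV. 4 * (g l \<omega> * B t \<omega> $ l - g l \<omega> * B s \<omega> $ l))
        = indicator A \<omega> * (\<Sum>l\<in>UNIV. 4 * (B s \<omega> $ l) ^ 3 * (B t \<omega> $ l - B s \<omega> $ l))"
      unfolding g_def by (auto simp: sum_distrib_left algebra_simps intro!: sum.cong)
    also have "\<dots> \<le> indicator A \<omega> * (\<Sum>l\<in>UNIV. (B t \<omega> $ l) ^ 4 - (B s \<omega> $ l) ^ 4)"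
      by (intro mult_left_mono sum_mono fourth_power_convex) auto
    finally show "(\<Sum>l\<in>UNIV. 4 * (g l \<omega> * B t \<omega> $ l - g l \<omega> * B s \<omega> $ l))
        \<le> indicator A \<omega> * (quartic (B t \<omega>) - quartic (B s \<omega>))"
      unfolding quartic_def by (simp add: sum_subtractf)
  qed
  finally show ?thesis .
qed

text \<open>
  The form of the submartingale property that the weighted maximal inequality asks for: discarding the
  complement of \<open>A\<close> only loses something nonnegative.
\<close>

lemma quartic_increment_le:
  assumes st: "0 \<le> s" "s \<le> t" and A: "A \<in> sets (F s)"
  shows "(\<integral>\<omega>. indicator A \<omega> * (quartic (B t \<omega>) - quartic (B s \<omega>)) \<partial>Q)
         \<le> (\<integral>\<omega>. quartic (B t \<omega>) \<partial>Q) - (\<integral>\<omega>. quartic (B s \<omega>) \<partial>Q)"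
proof -
  have t0: "0 \<le> t" using st by simp
  have qi: "integrable Q (\<lambda>\<omega>. quartic (B r \<omega>))" if "0 \<le> r" for r
    using quartic_integrable[OF that] unfolding B_def .
  define D where "D \<omega> = quartic (B t \<omega>) - quartic (B s \<omega>)" for \<omega>
  have Di: "integrable Q D" unfolding D_def[abs_def] using qi t0 st by auto
  have sp: "space (F s) = space Q" using sub(1)[OF st(1)] unfolding subalgebra_def by auto
  have AQ: "A \<in> sets Q" using A sub(1)[OF st(1)] unfolding subalgebra_def by auto
  have Ac: "space Q - A \<in> sets (F s)" using A sp by (metis sets.compl_sets)
  have i: "integrable Q (\<lambda>\<omega>. indicator S \<omega> * D \<omega>)" if "S \<in> sets Q" for S
    using integrable_real_mult_indicator[OF that Di] by (simp add: mult.commute)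
  have "(\<integral>\<omega>. D \<omega> \<partial>Q) = (\<integral>\<omega>. indicator A \<omega> * D \<omega> + indicator (space Q - A) \<omega> * D \<omega> \<partial>Q)"
    by (intro Bochner_Integration.integral_cong) (auto simp: indicator_def)
  also have "\<dots> = (\<integral>\<omega>. indicator A \<omega> * D \<omega> \<partial>Q) + (\<integral>\<omega>. indicator (space Q - A) \<omega> * D \<omega> \<partial>Q)"
    using AQ by (intro Bochner_Integration.integral_add i) auto
  finally have "(\<integral>\<omega>. indicator A \<omega> * D \<omega> \<partial>Q) \<le> (\<integral>\<omega>. D \<omega> \<partial>Q)"
    using quartic_submartingale[OF st Ac] unfolding D_def by linarith
  also have "(\<integral>\<omega>. D \<omega> \<partial>Q) = (\<integral>\<omega>. quartic (B t \<omega>) \<partial>Q) - (\<integral>\<omega>. quartic (B s \<omega>) \<partial>Q)"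
    unfolding D_def using qi t0 st by (intro Bochner_Integration.integral_diff) auto
  finally show ?thesis unfolding D_def .
qed

lemma linear_functional_martingale:
  assumes st: "0 \<le> s" "s \<le> t" and A: "A \<in> sets (F s)"
  shows "(\<integral>\<omega>. indicator A \<omega> * (a \<bullet> B t \<omega>) \<partial>Q) = (\<integral>\<omega>. indicator A \<omega> * (a \<bullet> B s \<omega>) \<partial>Q)"
proof -
  have t0: "0 \<le> t" using st by simp
  have AQ: "A \<in> sets Q" using A sub(1)[OF st(1)] unfolding subalgebra_def by auto
  have i: "integrable Q (\<lambda>\<omega>. indicator A \<omega> * B r \<omega> $ l)" if "0 \<le> r" for l r
    using integrable_real_mult_indicator[OF AQ B_integrable[OF that]] by (simp add: mult.commute)
  have e: "(\<integral>\<omega>. indicator A \<omega> * (a \<bullet> B r \<omega>) \<partial>Q) = (\<Sum>l\<in>UNIV. a $ l * (\<integral>\<omega>. indicator A \<omega> * B r \<omega> $ l \<partial>Q))"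
    if r: "0 \<le> r" for r
  proof -
    have "(\<lambda>\<omega>. indicator A \<omega> * (a \<bullet> B r \<omega>)) = (\<lambda>\<omega>. \<Sum>l\<in>UNIV. a $ l * (indicator A \<omega> * B r \<omega> $ l))"
      unfolding inner_vec_def by (auto simp: sum_distrib_left algebra_simps)
    then show ?thesis using i[OF r] by simp
  qed
  have "(\<integral>\<omega>. indicator A \<omega> * B t \<omega> $ l \<partial>Q) = (\<integral>\<omega>. indicator A \<omega> * B s \<omega> $ l \<partial>Q)" for l
    using A AQ i[OF t0] by (intro martingale_pairing[OF st]) (auto intro!: integrable_real_indicator simp: less_top[symmetric])
  then show ?thesis using e[OF t0] e[OF st(1)] by simp
qed

end

section \<open>The probability of confinement\<close>

context quartic_martingale
begin

definition good :: "real ^ 'n \<Rightarrow> real \<Rightarrow> real \<Rightarrow> real \<Rightarrow> 'w set" where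
  "good a \<epsilon> n t = {\<omega> \<in> space Q. quartic (B t \<omega>) \<le> (\<epsilon> * (n + t)) ^ 4 \<and> - n \<le> a \<bullet> B t \<omega>}"

lemma good_sets: "0 \<le> s \<Longrightarrow> s \<le> t \<Longrightarrow> good a \<epsilon> n s \<in> sets (F t)"
proof -
  assume st: "0 \<le> s" "s \<le> t"
  have [measurable]: "B s \<in> borel_measurable (F t)" by (rule B_measurable_F[OF st])
  have "space Q = space (F t)" using sub(1)[of t] st unfolding subalgebra_def by auto
  then show ?thesis unfolding good_def by simp
qed

lemma C_nonneg: "0 \<le> C"
proof -
  have "0 \<le> (\<integral>\<omega>. quartic (W 1 \<omega> - x) \<partial>Q)" by (intro integral_nonneg_AE) (simp add: quartic_nonneg)
  then show ?thesis using quartic_integral[of 1] by simp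
qed

text \<open>
  Confinement is lost either because \<open>a \<bullet> B\<close> falls below \<open>- n\<close>, or because the envelope is left. In the
  second case \<open>a \<bullet> B\<close> may be large, but then the gauge pays for it. The cube \<open>(\<epsilon> * (n + t)) ^ 3\<close> provides
  the weights of the maximal inequality.
\<close>

lemma overshoot_bound:
  assumes pos: "0 < \<epsilon>" "0 < n" "0 \<le> t"
    and \<omega>: "\<omega> \<in> space Q" "\<omega> \<notin> good a \<epsilon> n t"
  shows "a \<bullet> B t \<omega> \<le> - n + (l1_norm a + 1 / \<epsilon>) * (1 / (\<epsilon> * (n + t)) ^ 3 * quartic (B t \<omega>))"
proof -
  define \<rho> where "\<rho> = \<epsilon> * (n + t)"
  define q where "q = quartic (B t \<omega>)"
  have \<rho>: "0 < \<rho>" unfolding \<rho>_def using pos by simp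
  have q0: "0 \<le> q" unfolding q_def by (rule quartic_nonneg)
  have nn: "0 \<le> (l1_norm a + 1 / \<epsilon>) * (q / \<rho> ^ 3)"
    using l1_norm_nonneg[of a] pos \<rho> q0 by simp
  have "a \<bullet> B t \<omega> \<le> - n + (l1_norm a + 1 / \<epsilon>) * (q / \<rho> ^ 3)"
  proof (cases "\<rho> ^ 4 < q")
    case True
    have "\<bar>B t \<omega> $ l\<bar> \<le> q / \<rho> ^ 3" for l
      using component_le_quartic[of \<rho> "B t \<omega>" l] True \<rho> unfolding q_def by (simp add: pos_le_divide_eq)
    then have "\<bar>a \<bullet> B t \<omega>\<bar> \<le> l1_norm a * (q / \<rho> ^ 3)" by (rule abs_inner_le_l1_norm)
    moreover have "n \<le> 1 / \<epsilon> * (q / \<rho> ^ 3)"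
    proof -
      have "\<rho> * \<rho> ^ 3 < q" using True by (simp add: power_numeral_reduce)
      then have "\<rho> < q / \<rho> ^ 3" using \<rho> by (simp add: pos_less_divide_eq)
      moreover have "\<epsilon> * n \<le> \<rho>" unfolding \<rho>_def using pos by simp
      ultimately have "\<epsilon> * n \<le> q / \<rho> ^ 3" by linarith
      then have "1 / \<epsilon> * (\<epsilon> * n) \<le> 1 / \<epsilon> * (q / \<rho> ^ 3)" using pos by (intro mult_left_mono) auto
      then show ?thesis using pos by simp
    qed
    ultimately show ?thesis unfolding distrib_right by linarith
  next
    case False
    then have "a \<bullet> B t \<omega> < - n" using \<omega> unfolding good_def \<rho>_def q_def by auto
    then show ?thesis using nn by linarith
  qed
  then show ?thesis unfolding \<rho>_def q_def by simp
qed

text \<open>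
  The mean of \<open>a \<bullet> B\<close>, stopped when confinement is lost at a grid time, is zero. Paths that stop
  contribute about \<open>- n\<close> times their probability: the overshoot over the envelope adds at most \<open>n / 2\<close> by
  the maximal inequality, since \<open>n\<close> is large. Paths that stay confined must compensate this, but each
  of them contributes at most a multiple of \<open>\<epsilon> * (n + \<tau> m)\<close>, so their probability is bounded below by a
  multiple of \<open>1 / (n + \<tau> m)\<close>. The bound depends on the grid through its last point only.
\<close>

lemma grid_confinement:
  fixes \<tau> :: "nat \<Rightarrow> real"
  assumes pos: "0 < \<epsilon>" "0 < n"
    and \<tau>: "\<tau> 0 = 0" "\<And>k. \<tau> k \<le> \<tau> (Suc k)"
    and large: "(l1_norm a + 1 / \<epsilon>) * (C / \<epsilon> ^ 3 / n) \<le> n / 2"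
  shows "n / 2 \<le> prob (\<Inter>i\<le>m. good a \<epsilon> n (\<tau> i)) * (n + l1_norm a * (\<epsilon> * (n + \<tau> m)))"
proof -
  define A where "A k = (\<Inter>i\<le>k. good a \<epsilon> n (\<tau> i))" for k
  define \<phi> where "\<phi> k \<omega> = quartic (B (\<tau> k) \<omega>)" for k \<omega>
  define \<psi> where "\<psi> k \<omega> = a \<bullet> B (\<tau> k) \<omega>" for k \<omega>
  define c where "c k = 1 / (\<epsilon> * (n + \<tau> k)) ^ 3" for k
  define K where "K = l1_norm a + 1 / \<epsilon>"
  have K: "0 \<le> K" unfolding K_def using l1_norm_nonneg[of a] pos by simp
  have \<tau>mono: "\<tau> i \<le> \<tau> k" if "i \<le> k" for i k using \<tau>(2) that by (rule lift_Suc_mono_le)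
  have \<tau>0: "0 \<le> \<tau> k" for k using \<tau>mono[of 0 k] \<tau>(1) by simp
  have AF: "A k \<in> sets (F (\<tau> k))" for k
    unfolding A_def by (intro sets.finite_INT good_sets \<tau>0 \<tau>mono) auto
  have AQ: "A k \<in> sets Q" for k using AF sub(1)[OF \<tau>0] unfolding subalgebra_def by auto
  have Adec: "A (Suc k) \<subseteq> A k" for k unfolding A_def by auto
  have \<phi>i: "integrable Q (\<phi> k)" for k using quartic_integrable[OF \<tau>0] unfolding \<phi>_def[abs_def] B_def .
  have E\<phi>: "(\<integral>\<omega>. \<phi> k \<omega> \<partial>Q) = C * (\<tau> k)\<^sup>2" for k using quartic_integral[OF \<tau>0] unfolding \<phi>_def B_def .
  have \<psi>i: "integrable Q (\<psi> k)" for k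
    unfolding \<psi>_def[abs_def] inner_vec_def using B_integrable[OF \<tau>0] by simp
  have c: "0 \<le> c k" "c (Suc k) \<le> c k" for k
  proof -
    have p: "0 < \<epsilon> * (n + \<tau> k)" for k using pos \<tau>0[of k] by simp
    show "0 \<le> c k" unfolding c_def using p[of k] by simp
    have "\<epsilon> * (n + \<tau> k) \<le> \<epsilon> * (n + \<tau> (Suc k))" using \<tau>(2) pos by simp
    then show "c (Suc k) \<le> c k"
      unfolding c_def using p[of k] by (intro divide_left_mono power_mono mult_pos_pos zero_less_power p) auto
  qed
  have i\<phi>: "integrable Q (\<lambda>\<omega>. indicator S \<omega> * \<phi> k \<omega>)" if "S \<in> sets Q" for S k
    using integrable_real_mult_indicator[OF that \<phi>i[of k]] by (simp add: mult.commute)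
  have i\<psi>: "integrable Q (\<lambda>\<omega>. indicator S \<omega> * \<psi> k \<omega>)" if "S \<in> sets Q" for S k
    using integrable_real_mult_indicator[OF that \<psi>i[of k]] by (simp add: mult.commute)
  have i1: "integrable Q (\<lambda>\<omega>. indicator S \<omega> :: real)" if "S \<in> sets Q" for S
    using that by (auto intro!: integrable_real_indicator simp: less_top[symmetric])
  have "(\<Sum>k<m. c (Suc k) * (\<integral>\<omega>. indicator (A k - A (Suc k)) \<omega> * \<phi> (Suc k) \<omega> \<partial>Q))
      + c m * (\<integral>\<omega>. indicator (A m) \<omega> * \<phi> m \<omega> \<partial>Q)
    \<le> c 0 * (\<integral>\<omega>. \<phi> 0 \<omega> \<partial>Q) + (\<Sum>k<m. c (Suc k) * ((\<integral>\<omega>. \<phi> (Suc k) \<omega> \<partial>Q) - (\<integral>\<omega>. \<phi> k \<omega> \<partial>Q)))"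
  proof (rule weighted_maximal_inequality[where \<phi> = \<phi> and A = A and c = c])
    show "integrable Q (\<phi> k)" "A k \<in> sets Q" "A (Suc k) \<subseteq> A k" "0 \<le> c k" "c (Suc k) \<le> c k" for k
      by (fact \<phi>i AQ Adec c)+
    show "0 \<le> \<phi> k \<omega>" for k \<omega> unfolding \<phi>_def by (rule quartic_nonneg)
    show "(\<integral>\<omega>. indicator (A k) \<omega> * (\<phi> (Suc k) \<omega> - \<phi> k \<omega>) \<partial>Q) \<le> (\<integral>\<omega>. \<phi> (Suc k) \<omega> \<partial>Q) - (\<integral>\<omega>. \<phi> k \<omega> \<partial>Q)" for k
      unfolding \<phi>_def by (rule quartic_increment_le[OF \<tau>0 \<tau>(2) AF])
  qed
  moreover have "0 \<le> c m * (\<integral>\<omega>. indicator (A m) \<omega> * \<phi> m \<omega> \<partial>Q)"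
    using c(1) by (intro mult_nonneg_nonneg integral_nonneg_AE) (auto simp: \<phi>_def quartic_nonneg)
  moreover have "(\<Sum>k<m. c (Suc k) * ((\<integral>\<omega>. \<phi> (Suc k) \<omega> \<partial>Q) - (\<integral>\<omega>. \<phi> k \<omega> \<partial>Q))) \<le> C / \<epsilon> ^ 3 / n"
  proof -
    define h where "h k = (\<tau> k)\<^sup>2 / (n + \<tau> k)\<^sup>2" for k
    have "c (Suc k) * ((\<integral>\<omega>. \<phi> (Suc k) \<omega> \<partial>Q) - (\<integral>\<omega>. \<phi> k \<omega> \<partial>Q)) \<le> C / \<epsilon> ^ 3 / n * (h (Suc k) - h k)" for k
    proof -
      have "c (Suc k) * ((\<integral>\<omega>. \<phi> (Suc k) \<omega> \<partial>Q) - (\<integral>\<omega>. \<phi> k \<omega> \<partial>Q))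
          = C / \<epsilon> ^ 3 * (((\<tau> (Suc k))\<^sup>2 - (\<tau> k)\<^sup>2) / (n + \<tau> (Suc k)) ^ 3)"
        unfolding c_def E\<phi> by (simp add: power_mult_distrib right_diff_distrib diff_divide_distrib)
      also have "\<dots> \<le> C / \<epsilon> ^ 3 * ((h (Suc k) - h k) / n)"
        unfolding h_def using C_nonneg pos
        by (intro mult_left_mono sum_of_squares_increments_bound \<tau>0 \<tau>(2)) auto
      finally show ?thesis by simp
    qed
    then have "(\<Sum>k<m. c (Suc k) * ((\<integral>\<omega>. \<phi> (Suc k) \<omega> \<partial>Q) - (\<integral>\<omega>. \<phi> k \<omega> \<partial>Q)))
        \<le> (\<Sum>k<m. C / \<epsilon> ^ 3 / n * (h (Suc k) - h k))" by (intro sum_mono)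
    also have "\<dots> = C / \<epsilon> ^ 3 / n * (h m - h 0)"
      unfolding sum_distrib_left[symmetric] sum_lessThan_telescope ..
    also have "\<dots> \<le> C / \<epsilon> ^ 3 / n * 1"
    proof (rule mult_left_mono)
      have "(\<tau> m)\<^sup>2 \<le> (n + \<tau> m)\<^sup>2" using \<tau>0[of m] pos by (intro power_mono) auto
      then have "h m \<le> 1" unfolding h_def using pos \<tau>0[of m] by (auto simp: divide_le_eq_1)
      then show "h m - h 0 \<le> 1" unfolding h_def using \<tau>(1) by simp
    qed (use C_nonneg pos in auto)
    finally show ?thesis by simp
  qed
  moreover have "(\<integral>\<omega>. \<phi> 0 \<omega> \<partial>Q) = 0" unfolding E\<phi> \<tau>(1) by simp
  ultimately have HR: "(\<Sum>k<m. c (Suc k) * (\<integral>\<omega>. indicator (A k - A (Suc k)) \<omega> * \<phi> (Suc k) \<omega> \<partial>Q)) \<le> C / \<epsilon> ^ 3 / n"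
    by (simp only: mult_zero_right)

  have B0: "AE \<omega> in Q. B 0 \<omega> = 0" using start unfolding B_def by auto
  have "AE \<omega> in Q. \<omega> \<in> A 0"
    using B0 AE_space unfolding A_def good_def
    by eventually_elim (use \<tau>(1) pos in auto)
  then have PA0: "prob (A 0) = 1" using prob_eq_1[OF AQ[of 0]] by simp
  have "(\<integral>\<omega>. indicator (A 0) \<omega> * \<psi> 0 \<omega> \<partial>Q) = (\<integral>\<omega>. 0 \<partial>Q)"
  proof (rule integral_cong_AE)
    show "(\<lambda>\<omega>. indicator (A 0) \<omega> * \<psi> 0 \<omega>) \<in> borel_measurable Q" using i\<psi>[OF AQ] by auto
    show "AE \<omega> in Q. indicator (A 0) \<omega> * \<psi> 0 \<omega> = 0" using B0 unfolding \<psi>_def \<tau>(1) by eventually_elim auto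
  qed simp
  moreover have "(\<integral>\<omega>. indicator (A m) \<omega> * \<psi> m \<omega> \<partial>Q)
           + (\<Sum>k<m. \<integral>\<omega>. indicator (A k - A (Suc k)) \<omega> * \<psi> (Suc k) \<omega> \<partial>Q)
         = (\<integral>\<omega>. indicator (A 0) \<omega> * \<psi> 0 \<omega> \<partial>Q)"
  proof (rule optional_stopping_decomposition[where \<psi> = \<psi> and A = A])
    show "integrable Q (\<psi> k)" "A k \<in> sets Q" "A (Suc k) \<subseteq> A k" for k
      by (fact \<psi>i AQ Adec)+
    show "(\<integral>\<omega>. indicator (A k) \<omega> * \<psi> (Suc k) \<omega> \<partial>Q) = (\<integral>\<omega>. indicator (A k) \<omega> * \<psi> k \<omega> \<partial>Q)" for k
      unfolding \<psi>_def by (rule linear_functional_martingale[OF \<tau>0 \<tau>(2) AF])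
  qed
  ultimately have OS: "(\<integral>\<omega>. indicator (A m) \<omega> * \<psi> m \<omega> \<partial>Q)
           + (\<Sum>k<m. \<integral>\<omega>. indicator (A k - A (Suc k)) \<omega> * \<psi> (Suc k) \<omega> \<partial>Q) = 0" by simp

  \<comment> \<open>On the paths that are still confined the envelope bounds the functional.\<close>
  have "(\<integral>\<omega>. indicator (A m) \<omega> * \<psi> m \<omega> \<partial>Q) \<le> (\<integral>\<omega>. indicator (A m) \<omega> * (l1_norm a * (\<epsilon> * (n + \<tau> m))) \<partial>Q)"
  proof (rule integral_mono[OF i\<psi>[OF AQ]])
    show "integrable Q (\<lambda>\<omega>. indicator (A m) \<omega> * (l1_norm a * (\<epsilon> * (n + \<tau> m))))"
      using i1[OF AQ] by (rule integrable_mult_left)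
    fix \<omega>
    have "\<psi> m \<omega> \<le> l1_norm a * (\<epsilon> * (n + \<tau> m))" if "\<omega> \<in> A m"
    proof -
      have q: "quartic (B (\<tau> m) \<omega>) \<le> (\<epsilon> * (n + \<tau> m)) ^ 4" using that unfolding A_def good_def by auto
      have r: "0 \<le> \<epsilon> * (n + \<tau> m)" using pos \<tau>0[of m] by simp
      have "\<bar>a \<bullet> B (\<tau> m) \<omega>\<bar> \<le> l1_norm a * (\<epsilon> * (n + \<tau> m))"
        by (rule abs_inner_le_l1_norm) (rule quartic_le_component[OF q r])
      then show ?thesis unfolding \<psi>_def by linarith
    qed
    then show "indicator (A m) \<omega> * \<psi> m \<omega> \<le> indicator (A m) \<omega> * (l1_norm a * (\<epsilon> * (n + \<tau> m)))"
      by (auto simp: indicator_def)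
  qed
  also have "\<dots> = prob (A m) * (l1_norm a * (\<epsilon> * (n + \<tau> m)))"
    using AQ by (simp add: less_top[symmetric])
  finally have last: "(\<integral>\<omega>. indicator (A m) \<omega> * \<psi> m \<omega> \<partial>Q) \<le> prob (A m) * (l1_norm a * (\<epsilon> * (n + \<tau> m)))" .

  have "(\<integral>\<omega>. indicator (A k - A (Suc k)) \<omega> * \<psi> (Suc k) \<omega> \<partial>Q)
      \<le> n * prob (A (Suc k)) - n * prob (A k) + K * (c (Suc k) * (\<integral>\<omega>. indicator (A k - A (Suc k)) \<omega> * \<phi> (Suc k) \<omega> \<partial>Q))" for k
  proof -
    have D: "A k - A (Suc k) \<in> sets Q" using AQ by auto
    define I where "I = (indicator (A k - A (Suc k)) :: 'w \<Rightarrow> real)"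
    have iI: "integrable Q I" and iI\<phi>: "integrable Q (\<lambda>\<omega>. I \<omega> * \<phi> (Suc k) \<omega>)"
      unfolding I_def using i1[OF D] i\<phi>[OF D] by auto
    have "(\<integral>\<omega>. I \<omega> * \<psi> (Suc k) \<omega> \<partial>Q) \<le> (\<integral>\<omega>. (- n) * I \<omega> + K * c (Suc k) * (I \<omega> * \<phi> (Suc k) \<omega>) \<partial>Q)"
    proof (rule integral_mono)
      show "integrable Q (\<lambda>\<omega>. I \<omega> * \<psi> (Suc k) \<omega>)" unfolding I_def by (rule i\<psi>[OF D])
      show "integrable Q (\<lambda>\<omega>. (- n) * I \<omega> + K * c (Suc k) * (I \<omega> * \<phi> (Suc k) \<omega>))"
        using iI iI\<phi> by auto
      fix \<omega> assume sp: "\<omega> \<in> space Q"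
      show "I \<omega> * \<psi> (Suc k) \<omega> \<le> (- n) * I \<omega> + K * c (Suc k) * (I \<omega> * \<phi> (Suc k) \<omega>)"
      proof (cases "\<omega> \<in> A k - A (Suc k)")
        case True
        then have "\<omega> \<notin> good a \<epsilon> n (\<tau> (Suc k))" unfolding A_def by (auto simp: atMost_Suc)
        from overshoot_bound[OF pos \<tau>0 sp this] True show ?thesis
          unfolding I_def \<psi>_def \<phi>_def c_def K_def by simp
      qed (simp add: I_def)
    qed
    also have "\<dots> = (- n) * (\<integral>\<omega>. I \<omega> \<partial>Q) + K * c (Suc k) * (\<integral>\<omega>. I \<omega> * \<phi> (Suc k) \<omega> \<partial>Q)"
      using iI iI\<phi> by simp
    also have "(\<integral>\<omega>. I \<omega> \<partial>Q) = prob (A k) - prob (A (Suc k))"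
      unfolding I_def using D AQ Adec[of k] by (simp add: finite_measure_Diff)
    finally show ?thesis unfolding I_def by (simp add: algebra_simps)
  qed
  then have "(\<Sum>k<m. \<integral>\<omega>. indicator (A k - A (Suc k)) \<omega> * \<psi> (Suc k) \<omega> \<partial>Q)
      \<le> (\<Sum>k<m. (n * prob (A (Suc k)) - n * prob (A k))
            + K * (c (Suc k) * (\<integral>\<omega>. indicator (A k - A (Suc k)) \<omega> * \<phi> (Suc k) \<omega> \<partial>Q)))"
    by (intro sum_mono)
  also have "\<dots> = n * prob (A m) - n * prob (A 0)
      + K * (\<Sum>k<m. c (Suc k) * (\<integral>\<omega>. indicator (A k - A (Suc k)) \<omega> * \<phi> (Suc k) \<omega> \<partial>Q))"
    unfolding sum.distrib sum_distrib_left sum_lessThan_telescope[of "\<lambda>k. n * prob (A k)"] ..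
  also have "\<dots> \<le> n * prob (A m) - n + K * (C / \<epsilon> ^ 3 / n)"
    unfolding PA0 using mult_left_mono[OF HR K] by simp
  also have "\<dots> \<le> n * prob (A m) - n + n / 2" using large unfolding K_def by linarith
  finally have "0 \<le> prob (A m) * (l1_norm a * (\<epsilon> * (n + \<tau> m))) + (n * prob (A m) - n / 2)"
    using OS last by simp
  then show ?thesis unfolding A_def by (simp add: algebra_simps)
qed

text \<open>
  Dyadic grids are nested, so the events of confinement at grid times decrease and the bound survives
  in the limit; by continuity of the paths, confinement at all dyadic times is confinement at all
  times.
\<close>

lemma confinement_event:
  assumes pos: "0 < \<epsilon>" "0 < n" and T: "0 < T"
    and large: "(l1_norm a + 1 / \<epsilon>) * (C / \<epsilon> ^ 3 / n) \<le> n / 2"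
    and cont: "AE \<omega> in Q. continuous_on {0..} (\<lambda>t. W t \<omega>)"
  obtains E where "E \<in> sets Q" "n / 2 \<le> prob E * (n + l1_norm a * (\<epsilon> * (n + T)))"
    "AE \<omega> in Q. \<omega> \<in> E \<longrightarrow> confined_noise a \<epsilon> n T (\<lambda>t. W t \<omega> - x)"
proof -
  define G where "G j = (\<Inter>i\<le>(2::nat) ^ j. good a \<epsilon> n (T * i / 2 ^ j))" for j :: nat
  have sets_good: "good a \<epsilon> n t \<in> sets Q" if "0 \<le> t" for t
    using good_sets[OF that order_refl] sub(1)[OF that] unfolding subalgebra_def by auto
  have GQ: "G j \<in> sets Q" for j unfolding G_def using T by (intro sets.finite_INT sets_good) auto
  have "G (Suc j) \<subseteq> G j" for j
  proof
    fix \<omega> assume \<omega>: "\<omega> \<in> G (Suc j)"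
    have "\<omega> \<in> good a \<epsilon> n (T * i / 2 ^ j)" if "i \<le> 2 ^ j" for i :: nat
    proof -
      have "T * real i / 2 ^ j = T * real (2 * i) / 2 ^ Suc j" by simp
      moreover have "2 * i \<le> 2 ^ Suc j" using that by simp
      ultimately show ?thesis using \<omega> unfolding G_def by (metis (no_types, lifting) INT_E atMost_iff)
    qed
    then show "\<omega> \<in> G j" unfolding G_def by auto
  qed
  then have dec: "decseq G" by (rule decseq_SucI)
  define E where "E = (\<Inter>j. G j)"
  have "(\<lambda>j. prob (G j)) \<longlonglongrightarrow> prob E"
    unfolding E_def using GQ dec by (intro finite_Lim_measure_decseq) auto
  moreover have "n / 2 \<le> prob (G j) * (n + l1_norm a * (\<epsilon> * (n + T)))" for j
  proof -
    have "n / 2 \<le> prob (\<Inter>i\<le>2 ^ j. good a \<epsilon> n (T * real i / 2 ^ j)) * (n + l1_norm a * (\<epsilon> * (n + T * real (2 ^ j) / 2 ^ j)))"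
      by (rule grid_confinement[OF pos _ _ large]) (use T in \<open>auto intro!: divide_right_mono\<close>)
    then show ?thesis unfolding G_def by simp
  qed
  ultimately have bound: "n / 2 \<le> prob E * (n + l1_norm a * (\<epsilon> * (n + T)))"
    by (intro LIMSEQ_le_const[OF tendsto_mult_right]) auto
  have "confined_noise a \<epsilon> n T (\<lambda>t. W t \<omega> - x)"
    if \<omega>: "\<omega> \<in> E" and c: "continuous_on {0..} (\<lambda>t. W t \<omega>)" for \<omega>
  proof -
    have cB: "continuous_on {0..T} (\<lambda>t. B t \<omega>)"
      unfolding B_def using c by (auto intro!: continuous_intros intro: continuous_on_subset)
    define S where "S = {t \<in> {0..T}. quartic (B t \<omega>) \<le> (\<epsilon> * (n + t)) ^ 4} \<inter> {t \<in> {0..T}. - n \<le> a \<bullet> B t \<omega>}"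
    have "closed S"
      unfolding S_def by (intro closed_Int continuous_on_closed_Collect_le continuous_intros cB)
    have "t \<in> S" if t: "t \<in> {0..T}" for t
    proof -
      define s where "s j = T * real (nat \<lfloor>2 ^ j * (t / T)\<rfloor>) / 2 ^ j" for j :: nat
      have tT: "0 \<le> t / T" "t / T \<le> 1" using t T by auto
      have fl: "0 \<le> \<lfloor>2 ^ j * (t / T)\<rfloor>" for j :: nat
        unfolding zero_le_floor by (intro mult_nonneg_nonneg tT) simp
      have "s j \<in> S" for j
      proof -
        have "2 ^ j * (t / T) \<le> 2 ^ j * 1" by (intro mult_left_mono tT) simp
        then have "\<lfloor>2 ^ j * (t / T)\<rfloor> \<le> 2 ^ j" unfolding floor_le_iff by simp
        then have i: "nat \<lfloor>2 ^ j * (t / T)\<rfloor> \<le> 2 ^ j" by (simp add: nat_le_iff)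
        then have "\<omega> \<in> good a \<epsilon> n (s j)" using \<omega> unfolding E_def G_def s_def by auto
        moreover have "s j \<in> {0..T}"
        proof -
          have "real (nat \<lfloor>2 ^ j * (t / T)\<rfloor>) \<le> 2 ^ j" using i by (metis of_nat_le_iff of_nat_numeral of_nat_power)
          then have "T * real (nat \<lfloor>2 ^ j * (t / T)\<rfloor>) \<le> T * 2 ^ j" using T by (intro mult_left_mono) auto
          then show ?thesis unfolding s_def using T by (simp add: divide_le_eq)
        qed
        ultimately show ?thesis unfolding S_def good_def by auto
      qed
      moreover have "s \<longlonglongrightarrow> t"
      proof (rule tendsto_sandwich[of "\<lambda>j. t - T * (1 / 2) ^ j" _ _ "\<lambda>j. t"])
        have near: "real (nat \<lfloor>2 ^ j * (t / T)\<rfloor>) \<le> 2 ^ j * (t / T)" "2 ^ j * (t / T) - 1 \<le> real (nat \<lfloor>2 ^ j * (t / T)\<rfloor>)" for j :: nat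
          using fl[of j] by linarith+
        have eq: "T * (2 ^ j * (t / T)) / 2 ^ j = t" for j :: nat using T by simp
        have "s j \<le> T * (2 ^ j * (t / T)) / 2 ^ j" for j
          unfolding s_def using T near(1)[of j] by (intro divide_right_mono mult_left_mono) auto
        then show "\<forall>\<^sub>F j in sequentially. s j \<le> t" unfolding eq by simp
        have "T * (2 ^ j * (t / T) - 1) / 2 ^ j \<le> s j" for j
          unfolding s_def using T near(2)[of j] by (intro divide_right_mono mult_left_mono) auto
        moreover have "T * (2 ^ j * (t / T) - 1) / 2 ^ j = t - T * (1 / 2) ^ j" for j :: nat
          unfolding right_diff_distrib diff_divide_distrib eq by (simp add: power_one_over)
        ultimately show "\<forall>\<^sub>F j in sequentially. t - T * (1 / 2) ^ j \<le> s j" by simp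
        have "(\<lambda>j. t - T * (1 / 2) ^ j) \<longlonglongrightarrow> t - T * 0"
          by (intro tendsto_intros LIMSEQ_power_zero) auto
        then show "(\<lambda>j. t - T * (1 / 2) ^ j) \<longlonglongrightarrow> t" by simp
      qed simp
      ultimately show ?thesis using \<open>closed S\<close> by (meson closed_sequentially)
    qed
    then have S: "quartic (B t \<omega>) \<le> (\<epsilon> * (n + t)) ^ 4" "- n \<le> a \<bullet> B t \<omega>" if "t \<in> {0..T}" for t
      using that unfolding S_def by auto
    have "\<bar>B t \<omega> $ l\<bar> \<le> \<epsilon> * (n + t)" if "t \<in> {0..T}" for t l
      by (rule quartic_le_component[OF S(1)[OF that]]) (use that pos in auto)
    then show ?thesis using S(2) unfolding confined_noise_def B_def by auto
  qed
  then have "AE \<omega> in Q. \<omega> \<in> E \<longrightarrow> confined_noise a \<epsilon> n T (\<lambda>t. W t \<omega> - x)"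
    using cont by auto
  moreover have "E \<in> sets Q" unfolding E_def using GQ by auto
  ultimately show thesis using that bound by blast
qed

end

text \<open>
  The number of indices \<open>k\<close> with \<open>\<omega> \<in> E k\<close> is at most \<open>H \<omega>\<close>, and its expectation, the sum of the
  probabilities of the events, diverges like the harmonic series.
\<close>

lemma infinite_expectation_of_harmonic_tail:
  fixes H :: "'w \<Rightarrow> ennreal"
  assumes "prob_space Q" and E: "\<And>k. E k \<in> sets Q"
    and d: "0 < d" "\<And>k. d / real (Suc k) \<le> measure Q (E k)"
    and H: "\<And>k. AE \<omega> in Q. \<omega> \<in> E k \<longrightarrow> ennreal (real (Suc k)) \<le> H \<omega>"
  shows "(\<integral>\<^sup>+ \<omega>. H \<omega> \<partial>Q) = \<infinity>"
proof -
  interpret prob_space Q by fact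
  have "AE \<omega> in Q. \<forall>k. \<omega> \<in> E k \<longrightarrow> ennreal (real (Suc k)) \<le> H \<omega>"
    unfolding AE_all_countable using H by simp
  then have le: "AE \<omega> in Q. (\<Sum>k. indicator (E k) \<omega> :: ennreal) \<le> H \<omega>"
  proof eventually_elim
    case (elim \<omega>)
    show ?case
    proof (cases "H \<omega>")
      case (real r)
      define N where "N = nat \<lfloor>r\<rfloor>"
      have "indicator (E k) \<omega> = (0 :: ennreal)" if "k \<notin> {..<N}" for k
      proof (rule ccontr)
        assume "\<not> ?thesis"
        then have "ennreal (real (Suc k)) \<le> ennreal r" using elim real by (auto simp: indicator_def split: if_splits)
        then have "real (Suc k) \<le> r" using real(1) by (subst (asm) ennreal_le_iff) auto
        then have "k < N" unfolding N_def by linarith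
        then show False using that by simp
      qed
      then have "(\<Sum>k. indicator (E k) \<omega> :: ennreal) = (\<Sum>k<N. indicator (E k) \<omega>)" by (intro suminf_finite) auto
      also have "\<dots> \<le> (\<Sum>k<N. 1)" by (intro sum_mono) (auto simp: indicator_def)
      also have "\<dots> = ennreal (real N)" by (simp add: ennreal_of_nat_eq_real_of_nat)
      also have "\<dots> \<le> H \<omega>" unfolding real N_def using real by (intro ennreal_leI) (simp add: of_nat_floor)
      finally show ?thesis .
    qed simp
  qed
  have diverges: "(\<Sum>k. ennreal (d / real (Suc k))) = \<infinity>"
  proof (rule ccontr)
    assume "\<not> ?thesis"
    then have "summable (\<lambda>k. d / real (Suc k))"
      using d(1) by (intro summable_suminf_not_top) (auto simp: infinity_ennreal_def)
    then have "summable (\<lambda>k. (1 / d) * (d / real (Suc k)))" by (rule summable_mult)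
    then have "summable (\<lambda>k. inverse (real (Suc k)))" using d(1) by (simp add: field_simps)
    then show False using not_summable_harmonic[where 'a = real] by (subst (asm) summable_Suc_iff) auto
  qed
  have "(\<Sum>k. ennreal (d / real (Suc k))) \<le> (\<Sum>k. emeasure Q (E k))"
    using d(2) by (intro suminf_le) (auto simp: emeasure_eq_measure intro!: ennreal_leI simp del: of_nat_Suc)
  also have "\<dots> = (\<integral>\<^sup>+ \<omega>. (\<Sum>k. indicator (E k) \<omega>) \<partial>Q)"
    using E by (subst nn_integral_suminf) auto
  also have "\<dots> \<le> (\<integral>\<^sup>+ \<omega>. H \<omega> \<partial>Q)" using le by (rule nn_integral_mono_AE)
  finally show ?thesis using diverges by (simp add: top_unique)
qed

section \<open>Fourth moments of Brownian motion\<close>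

lemma det_scaleR:
  fixes A :: "real ^ 'n ^ 'n"
  shows "det (c *\<^sub>R A) = c ^ CARD('n) * det A"
  by (simp add: det_def prod.distrib sum_distrib_left mult.commute mult.left_commute)

lemma scaleR_matrix_vector: "(c *\<^sub>R A) *v y = c *\<^sub>R (A *v y)" for A :: "real ^ 'n ^ 'm"
  by (simp add: scaleR_matrix_vector_assoc)

lemma matrix_inv_mult_vec:
  fixes A :: "real ^ 'n ^ 'n"
  assumes "invertible A"
  shows "A *v (matrix_inv A *v y) = y" "matrix_inv A *v (A *v y) = y"
  using someI_ex[of "\<lambda>A'. A ** A' = mat 1 \<and> A' ** A = mat 1"] assms
  unfolding matrix_inv_def[symmetric] invertible_def by (simp_all add: matrix_vector_mul_assoc)

lemma symmetric_positive_definite_invertible: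
  assumes "symmetric_positive_definite A"
  shows "invertible A"
proof -
  have "x = 0" if "A *v x = 0" for x
    using assms that unfolding symmetric_positive_definite_def by (metis inner_zero_right less_irrefl)
  then show ?thesis by (simp add: invertible_left_inverse matrix_left_invertible_ker)
qed

lemma inverse_scaled_matrix_vec:
  fixes A :: "real ^ 'n ^ 'n"
  assumes "invertible A" "c \<noteq> 0"
  shows "matrix_inv (c *\<^sub>R A) *v y = inverse c *\<^sub>R (matrix_inv A *v y)"
proof -
  have "invertible (c *\<^sub>R A)"
    using assms by (simp add: invertible_det_nz det_scaleR)
  moreover have "(c *\<^sub>R A) *v (inverse c *\<^sub>R (matrix_inv A *v y)) = y"
    using assms by (simp add: scaleR_matrix_vector matrix_vector_mult_scaleR matrix_inv_mult_vec)
  ultimately show ?thesis by (metis matrix_inv_mult_vec(2))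
qed

text \<open>
  The fourth moment of the centred normal distribution, as an extended nonnegative number because its
  finiteness has yet to be shown.
\<close>

definition quartic_moment :: "real ^ 'n ^ 'n \<Rightarrow> ennreal" where
  "quartic_moment \<Gamma> = (\<integral>\<^sup>+ z. ennreal (mvn_density \<Gamma> z) * ennreal (quartic z) \<partial>lborel)"

lemma mvn_density_scaled:
  fixes \<Gamma> :: "real ^ 'n ^ 'n"
  assumes "invertible \<Gamma>" "0 < t"
  shows "sqrt t ^ CARD('n) * mvn_density (t *\<^sub>R \<Gamma>) (sqrt t *\<^sub>R z) = mvn_density \<Gamma> z"
proof -
  have "sqrt t * (inverse t * sqrt t) = inverse t * (sqrt t * sqrt t)" by (simp only: mult_ac)
  then have t: "sqrt t * (inverse t * sqrt t) = 1" using assms by simp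
  have "sqrt t *\<^sub>R z \<bullet> (matrix_inv (t *\<^sub>R \<Gamma>) *v (sqrt t *\<^sub>R z)) = z \<bullet> (matrix_inv \<Gamma> *v z)"
    using assms by (simp add: inverse_scaled_matrix_vec matrix_vector_mult_scaleR t)
  moreover have "sqrt ((2 * pi) ^ CARD('n) * det (t *\<^sub>R \<Gamma>)) = sqrt t ^ CARD('n) * sqrt ((2 * pi) ^ CARD('n) * det \<Gamma>)"
    by (simp add: det_scaleR real_sqrt_mult real_sqrt_power)
  ultimately show ?thesis unfolding mvn_density_def using assms by simp
qed

lemma borel_measurable_mvn_density [measurable]: "mvn_density \<Gamma> \<in> borel_measurable borel"
proof -
  have [measurable]: "(\<lambda>y. y \<bullet> (matrix_inv \<Gamma> *v y)) \<in> borel_measurable borel"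
    by (intro borel_measurable_continuous_onI continuous_intros matrix_vector_mult_linear_continuous_on)
  show ?thesis unfolding mvn_density_def[abs_def] by measurable
qed

text \<open>
  Brownian scaling: substitute \<open>sqrt t *\<^sub>R z\<close>.
\<close>

lemma quartic_moment_scaled:
  fixes \<Gamma> :: "real ^ 'n ^ 'n"
  assumes "invertible \<Gamma>" "0 < t"
  shows "quartic_moment (t *\<^sub>R \<Gamma>) = ennreal (t\<^sup>2) * quartic_moment \<Gamma>"
proof -
  have 4: "sqrt t ^ 4 = t\<^sup>2" using assms by (simp add: power4_eq_xxxx power2_eq_square)
  have "quartic_moment (t *\<^sub>R \<Gamma>) = (\<integral>\<^sup>+ z. ennreal (mvn_density (t *\<^sub>R \<Gamma>) z) * ennreal (quartic z)
      \<partial>density (distr lborel borel (\<lambda>z. 0 + sqrt t *\<^sub>R z)) (\<lambda>_. \<bar>sqrt t\<bar> ^ DIM(real ^ 'n)))"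
    unfolding quartic_moment_def using assms by (subst lborel_affine[of "sqrt t" 0]) auto
  also have "\<dots> = (\<integral>\<^sup>+ z. ennreal (sqrt t ^ CARD('n)) * (ennreal (mvn_density (t *\<^sub>R \<Gamma>) (sqrt t *\<^sub>R z)) * ennreal (quartic (sqrt t *\<^sub>R z))) \<partial>lborel)"
    using assms by (simp add: nn_integral_density nn_integral_distr)
  also have "\<dots> = (\<integral>\<^sup>+ z. ennreal (t\<^sup>2) * (ennreal (mvn_density \<Gamma> z) * ennreal (quartic z)) \<partial>lborel)"
  proof (intro nn_integral_cong)
    fix z :: "real ^ 'n"
    have "ennreal (sqrt t ^ CARD('n)) * ennreal (mvn_density (t *\<^sub>R \<Gamma>) (sqrt t *\<^sub>R z)) = ennreal (mvn_density \<Gamma> z)"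
      using assms by (subst ennreal_mult'[symmetric]) (simp_all add: mvn_density_scaled)
    moreover have "ennreal (quartic (sqrt t *\<^sub>R z)) = ennreal (t\<^sup>2) * ennreal (quartic z)"
      unfolding quartic_scaleR 4 by (rule ennreal_mult') simp
    ultimately show "ennreal (sqrt t ^ CARD('n)) * (ennreal (mvn_density (t *\<^sub>R \<Gamma>) (sqrt t *\<^sub>R z)) * ennreal (quartic (sqrt t *\<^sub>R z)))
        = ennreal (t\<^sup>2) * (ennreal (mvn_density \<Gamma> z) * ennreal (quartic z))"
      by (metis mult.assoc mult.commute)
  qed
  also have "\<dots> = ennreal (t\<^sup>2) * quartic_moment \<Gamma>"
    unfolding quartic_moment_def by (intro nn_integral_cmult) measurable
  finally show ?thesis .
qed

lemma inverse_form_coercive: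
  fixes \<Gamma> :: "real ^ 'n ^ 'n"
  assumes spd: "symmetric_positive_definite \<Gamma>"
  obtains c where "0 < c" "\<And>z. c * (z \<bullet> z) \<le> z \<bullet> (matrix_inv \<Gamma> *v z)"
proof -
  define h where "h z = z \<bullet> (matrix_inv \<Gamma> *v z)" for z
  note inv = symmetric_positive_definite_invertible[OF spd]
  have hpos: "0 < h z" if "z \<noteq> 0" for z
  proof -
    define w where "w = matrix_inv \<Gamma> *v z"
    have "\<Gamma> *v w = z" unfolding w_def by (simp add: matrix_inv_mult_vec inv)
    then have "w \<noteq> 0" using that by auto
    then have "0 < w \<bullet> (\<Gamma> *v w)" using spd unfolding symmetric_positive_definite_def by blast
    then show ?thesis unfolding \<open>\<Gamma> *v w = z\<close> unfolding h_def w_def[symmetric] by (simp add: inner_commute)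
  qed
  have "continuous_on (sphere 0 1) h"
    unfolding h_def by (intro continuous_intros matrix_vector_mult_linear_continuous_on)
  moreover have "axis undefined 1 \<in> sphere (0 :: real ^ 'n) 1" by simp
  ultimately obtain w where w: "w \<in> sphere 0 1" "\<And>z. z \<in> sphere 0 1 \<Longrightarrow> h w \<le> h z"
    using continuous_attains_inf[of "sphere 0 1" h] by auto
  show thesis
  proof
    show "0 < h w" using w(1) by (intro hpos) auto
    fix z :: "real ^ 'n"
    show "h w * (z \<bullet> z) \<le> z \<bullet> (matrix_inv \<Gamma> *v z)"
    proof (cases "z = 0")
      case False
      define e where "e = inverse (norm z) *\<^sub>R z"
      have "e \<in> sphere 0 1" unfolding e_def using False by simp
      then have "h w \<le> h e" by (rule w(2))
      also have "h e = h z / (z \<bullet> z)"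
        unfolding h_def e_def by (simp add: matrix_vector_mult_scaleR dot_square_norm power2_eq_square field_simps)
      finally have "h w \<le> h z / (z \<bullet> z)" .
      then show ?thesis using False unfolding h_def by (simp add: pos_le_divide_eq)
    qed simp
  qed
qed

lemma quartic_le_norm_fourth: "quartic (z :: real ^ 'n) \<le> CARD('n) * (z \<bullet> z)\<^sup>2"
proof -
  have "(z $ l) ^ 4 \<le> (z \<bullet> z)\<^sup>2" for l
  proof -
    have "(z $ l)\<^sup>2 \<le> z \<bullet> z"
      unfolding inner_vec_def power2_eq_square inner_real_def by (rule member_le_sum) auto
    then have "((z $ l)\<^sup>2)\<^sup>2 \<le> (z \<bullet> z)\<^sup>2" by (intro power_mono) auto
    then show ?thesis by (simp flip: power_mult)
  qed
  then have "quartic z \<le> (\<Sum>l\<in>(UNIV :: 'n set). (z \<bullet> z)\<^sup>2)" unfolding quartic_def by (intro sum_mono)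
  then show ?thesis by simp
qed

lemma gaussian_product_finite:
  assumes "0 < c"
  shows "(\<integral>\<^sup>+ z. ennreal (exp (- c * (z \<bullet> z))) \<partial>(lborel :: (real ^ 'n) measure)) < \<infinity>"
proof -
  have one: "(\<integral>\<^sup>+ s. ennreal (exp (- c * s\<^sup>2)) \<partial>lborel) < \<infinity>"
  proof -
    define \<sigma> where "\<sigma> = sqrt (1 / (2 * c))"
    have \<sigma>: "0 < \<sigma>" "\<sigma>\<^sup>2 = 1 / (2 * c)" unfolding \<sigma>_def using assms by auto
    have "integrable lborel (\<lambda>s. sqrt (2 * pi * \<sigma>\<^sup>2) * normal_density 0 \<sigma> s)"
      using integrable_normal_density[OF \<sigma>(1)] by auto
    moreover have "(\<lambda>s. sqrt (2 * pi * \<sigma>\<^sup>2) * normal_density 0 \<sigma> s) = (\<lambda>s. exp (- c * s\<^sup>2))"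
      unfolding normal_density_def using \<sigma> assms by (auto simp: field_simps)
    ultimately have "integrable lborel (\<lambda>s. exp (- c * s\<^sup>2))" by simp
    then show ?thesis by (simp add: integrable_iff_bounded)
  qed
  have e: "ennreal (exp (- c * (z \<bullet> z))) = (\<Prod>b\<in>Basis. ennreal (exp (- c * (z \<bullet> b)\<^sup>2)))" for z :: "real ^ 'n"
  proof -
    have "z \<bullet> z = (\<Sum>b\<in>Basis. (z \<bullet> b)\<^sup>2)" by (subst euclidean_inner) (simp add: power2_eq_square)
    then have "exp (- c * (z \<bullet> z)) = (\<Prod>b\<in>Basis. exp (- c * (z \<bullet> b)\<^sup>2))"
      by (simp add: sum_distrib_left exp_sum sum_negf[symmetric])
    then show ?thesis by (simp add: prod_ennreal)
  qed
  have "(\<integral>\<^sup>+ z. ennreal (exp (- c * (z \<bullet> z))) \<partial>(lborel :: (real ^ 'n) measure))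
      = (\<Prod>b\<in>(Basis :: (real ^ 'n) set). \<integral>\<^sup>+ s. ennreal (exp (- c * s\<^sup>2)) \<partial>lborel)"
    unfolding e by (rule nn_integral_lborel_prod) auto
  also have "\<dots> < \<infinity>" using one by (simp add: power_less_top_ennreal less_top)
  finally show ?thesis .
qed

text \<open>
  By coercivity of the inverse covariance form, half of the Gaussian exponent absorbs the polynomial
  factor, and the other half leaves a product of one-dimensional Gaussians.
\<close>

lemma quartic_moment_finite:
  fixes \<Gamma> :: "real ^ 'n ^ 'n"
  assumes spd: "symmetric_positive_definite \<Gamma>"
  shows "quartic_moment \<Gamma> < \<infinity>"
proof -
  obtain c where c: "0 < c" "\<And>z. c * (z \<bullet> z) \<le> z \<bullet> (matrix_inv \<Gamma> *v z)"
    using inverse_form_coercive[OF spd] by blast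
  define L where "L = \<bar>1 / sqrt ((2 * pi) ^ CARD('n) * det \<Gamma>)\<bar>"
  define D where "D = real CARD('n) * L * (2 * (4 / c)\<^sup>2)"
  have L: "0 \<le> L" unfolding L_def by simp
  have "mvn_density \<Gamma> z * quartic z \<le> D * exp (- (c / 4) * (z \<bullet> z))" for z
  proof -
    define r where "r = z \<bullet> z"
    have r: "0 \<le> r" unfolding r_def by simp
    have "mvn_density \<Gamma> z \<le> \<bar>mvn_density \<Gamma> z\<bar>" by simp
    also have "\<dots> = exp (- (z \<bullet> (matrix_inv \<Gamma> *v z)) / 2) * L"
      unfolding mvn_density_def L_def by (simp add: abs_mult)
    also have "\<dots> \<le> exp (- (c / 2) * r) * L"
      unfolding r_def using c(2)[of z] L by (intro mult_right_mono) auto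
    finally have "mvn_density \<Gamma> z * quartic z \<le> exp (- (c / 2) * r) * L * (CARD('n) * r\<^sup>2)"
      using quartic_le_norm_fourth[of z] L unfolding r_def
      by (intro mult_mono) (auto simp: quartic_nonneg)
    also have "\<dots> \<le> exp (- (c / 2) * r) * L * (CARD('n) * ((2 * (4 / c)\<^sup>2) * exp (c / 4 * r)))"
    proof (intro mult_left_mono)
      have "(c / 4 * r)\<^sup>2 / 2 \<le> exp (c / 4 * r)"
        using exp_lower_Taylor_quadratic[of "c / 4 * r"] c r by (smt (verit) divide_nonneg_nonneg mult_nonneg_nonneg)
      then have "2 * (4 / c)\<^sup>2 * ((c / 4 * r)\<^sup>2 / 2) \<le> 2 * (4 / c)\<^sup>2 * exp (c / 4 * r)"
        by (intro mult_left_mono) auto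
      then show "r\<^sup>2 \<le> 2 * (4 / c)\<^sup>2 * exp (c / 4 * r)"
        using c by (simp add: power_mult_distrib power_divide)
    qed (use L in auto)
    also have "\<dots> = D * (exp (- (c / 2) * r) * exp (c / 4 * r))" unfolding D_def by (simp add: algebra_simps)
    also have "exp (- (c / 2) * r) * exp (c / 4 * r) = exp (- (c / 4) * r)"
      unfolding exp_add[symmetric] by (simp add: algebra_simps)
    finally show ?thesis unfolding r_def .
  qed
  then have "quartic_moment \<Gamma> \<le> (\<integral>\<^sup>+ z. ennreal D * ennreal (exp (- (c / 4) * (z \<bullet> z))) \<partial>(lborel :: (real ^ 'n) measure))"
    unfolding quartic_moment_def using L D_def
    by (intro nn_integral_mono) (auto simp: ennreal_mult''[symmetric] quartic_nonneg intro!: ennreal_leI)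
  also have "\<dots> = ennreal D * (\<integral>\<^sup>+ z. ennreal (exp (- (c / 4) * (z \<bullet> z))) \<partial>(lborel :: (real ^ 'n) measure))"
    by (intro nn_integral_cmult) measurable
  also have "\<dots> < \<infinity>"
    using gaussian_product_finite[where 'n = 'n, of "c / 4"] c(1) by (simp add: ennreal_mult_less_top)
  finally show ?thesis .
qed

lemma driftless_brownian_motion_quartic:
  fixes \<Gamma> :: "real ^ 'n ^ 'n"
  assumes spd: "symmetric_positive_definite \<Gamma>" and Q: "prob_space Q"
    and bm: "driftless_brownian_motion Q x \<Gamma> W" and t: "0 \<le> t"
  shows "integrable Q (\<lambda>\<omega>. quartic (W t \<omega> - x))"
    and "(\<integral>\<omega>. quartic (W t \<omega> - x) \<partial>Q) = enn2real (quartic_moment \<Gamma>) * t\<^sup>2"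
proof -
  interpret prob_space Q by fact
  have W: "W s \<in> borel_measurable Q" if "0 \<le> s" for s
    using bm that unfolding driftless_brownian_motion_def by auto
  have start: "AE \<omega> in Q. W 0 \<omega> = x" using bm unfolding driftless_brownian_motion_def by auto
  note [measurable] = W[OF t] W[OF order_refl]
  have meas: "(\<lambda>\<omega>. quartic (W t \<omega> - x)) \<in> borel_measurable Q" by measurable
  define m where "m = enn2real (quartic_moment \<Gamma>)"
  have m: "quartic_moment \<Gamma> = ennreal m" "0 \<le> m"
    unfolding m_def using quartic_moment_finite[OF spd] by (auto simp: less_top)
  have "(\<integral>\<^sup>+ \<omega>. ennreal (quartic (W t \<omega> - x)) \<partial>Q) = ennreal (m * t\<^sup>2)"
  proof (cases "t = 0")
    case True
    have "(\<integral>\<^sup>+ \<omega>. ennreal (quartic (W t \<omega> - x)) \<partial>Q) = (\<integral>\<^sup>+ \<omega>. 0 \<partial>Q)"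
      using start True by (intro nn_integral_cong_AE) auto
    then show ?thesis using True by simp
  next
    case False
    then have "0 < t" using t by simp
    then have d: "distributed Q lborel (\<lambda>\<omega>. W t \<omega> - W 0 \<omega>) (\<lambda>y. ennreal (mvn_density ((t - 0) *\<^sub>R \<Gamma>) y))"
      using bm unfolding driftless_brownian_motion_def by blast
    have "(\<integral>\<^sup>+ \<omega>. ennreal (quartic (W t \<omega> - x)) \<partial>Q) = (\<integral>\<^sup>+ \<omega>. ennreal (quartic (W t \<omega> - W 0 \<omega>)) \<partial>Q)"
      using start by (intro nn_integral_cong_AE) auto
    also have "\<dots> = quartic_moment (t *\<^sub>R \<Gamma>)"
      unfolding quartic_moment_def using distributed_nn_integral[OF d, of "\<lambda>y. ennreal (quartic y)"] by simp
    also have "\<dots> = ennreal (m * t\<^sup>2)"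
      using quartic_moment_scaled[OF symmetric_positive_definite_invertible[OF spd] \<open>0 < t\<close>] m
      by (simp add: ennreal_mult mult.commute)
    finally show ?thesis .
  qed
  then have "has_bochner_integral Q (\<lambda>\<omega>. quartic (W t \<omega> - x)) (m * t\<^sup>2)"
    using meas m by (intro has_bochner_integral_nn_integral) (auto simp: quartic_nonneg)
  then show "integrable Q (\<lambda>\<omega>. quartic (W t \<omega> - x))"
    and "(\<integral>\<omega>. quartic (W t \<omega> - x) \<partial>Q) = enn2real (quartic_moment \<Gamma>) * t\<^sup>2"
    unfolding m_def by (auto simp: has_bochner_integral_iff)
qed

section \<open>Escaping paths contradict positive recurrence\<close>

text \<open>
  The Stieltjes measure of \<open>{s<..t}\<close> is the increment of \<open>y\<close>, and the integrand is \<open>1\<close> there.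
\<close>

lemma flat_where_integrand_positive:
  fixes g y :: "real \<Rightarrow> real"
  assumes mono: "mono_on {0..} y" and cont: "continuous_on {0..} y"
    and null: "(\<integral>\<^sup>+ s\<in>{0..}. indicator {s. g s \<noteq> 0} s \<partial>stieltjes_measure y) = 0"
    and st: "0 \<le> s" "s \<le> t" and pos: "\<forall>r\<in>{s<..t}. 0 < g r"
  shows "y t = y s"
proof -
  define f where "f r = y (max 0 r)" for r
  have f_mono: "f p \<le> f q" if "p \<le> q" for p q
    unfolding f_def using that by (intro mono_onD[OF mono]) auto
  have "continuous_on UNIV f"
    unfolding f_def by (rule continuous_on_compose2[OF cont]) (auto intro!: continuous_intros)
  then have "continuous (at_right r) f" for r
    by (simp add: continuous_on_eq_continuous_at continuous_at_imp_continuous_at_within)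
  then have "ennreal (f t - f s) = emeasure (interval_measure f) {s<..t}"
    by (intro emeasure_interval_measure_Ioc[symmetric] st f_mono)
  also have "emeasure (interval_measure f) {s<..t} = (\<integral>\<^sup>+ r. indicator {s<..t} r \<partial>interval_measure f)"
    by simp
  also have "\<dots> \<le> (\<integral>\<^sup>+ r\<in>{0..}. indicator {s. g s \<noteq> 0} r \<partial>stieltjes_measure y)"
    unfolding stieltjes_measure_def f_def[symmetric] using st pos
    by (intro nn_integral_mono) (force simp: indicator_def)
  finally have "ennreal (f t - f s) = 0" using null by simp
  then have "f t \<le> f s" by (simp add: ennreal_eq_0_iff)
  then show ?thesis using f_mono[OF st(2)] st unfolding f_def by (simp add: max_def)
qed

text \<open>
  Almost every path of the process is a reflected path in the pathwise sense, with driftless Brownian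
  motion, centred at the starting point, as its noise.
\<close>

lemma srbm_decomposition:
  fixes Z :: "real \<Rightarrow> 'w \<Rightarrow> real ^ 'n"
  assumes srbm: "srbm M F P Z \<theta> \<Gamma> R" and x: "x \<in> nonneg_orthant"
  obtains W Y where
    "prob_space (P x)" "filtered_space (P x) F"
    "driftless_brownian_motion (P x) x \<Gamma> W" "martingale (P x) F W"
    "AE \<omega> in P x. \<forall>T. reflected_path \<theta> R x T (\<lambda>t. W t \<omega> - x) (\<lambda>t. Y t \<omega>) (\<lambda>t. Z t \<omega>)"
proof -
  have filt: "filtered_space M F"
    and Z: "\<And>\<omega>. \<omega> \<in> space M \<Longrightarrow> continuous_on {0..} (\<lambda>t. Z t \<omega>) \<and> (\<forall>t\<ge>0. Z t \<omega> \<in> nonneg_orthant)"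
    using srbm unfolding srbm_def by blast+
  obtain X Y where P: "prob_space (P x)" "space (P x) = space M" "sets (P x) = sets M"
    and W: "driftless_brownian_motion (P x) x \<Gamma> (\<lambda>t \<omega>. X t \<omega> - t *\<^sub>R \<theta>)"
      "martingale (P x) F (\<lambda>t \<omega>. X t \<omega> - t *\<^sub>R \<theta>)"
    and ae: "AE \<omega> in P x.
              (\<forall>t\<ge>0. Z t \<omega> = X t \<omega> + R *v Y t \<omega>) \<and>
              Y 0 \<omega> = 0 \<and>
              continuous_on {0..} (\<lambda>t. Y t \<omega>) \<and>
              (\<forall>j. mono_on {0..} (\<lambda>t. Y t \<omega> $ j)) \<and>
              (\<forall>j. (\<integral>\<^sup>+ s\<in>{0..}. indicator {s. Z s \<omega> $ j \<noteq> 0} s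
                     \<partial>stieltjes_measure (\<lambda>t. Y t \<omega> $ j)) = 0)"
    using srbm[unfolded srbm_def, THEN conjunct2, THEN conjunct2, THEN conjunct2, THEN bspec, OF x]
    by (elim conjE exE) (rule that; assumption)
  have start: "AE \<omega> in P x. X 0 \<omega> - 0 *\<^sub>R \<theta> = x"
    using W(1) unfolding driftless_brownian_motion_def by blast
  have "filtered_space (P x) F"
    using filt P(2,3) unfolding filtered_space_def subalgebra_def by simp
  moreover have "AE \<omega> in P x. \<forall>T. reflected_path \<theta> R x T (\<lambda>t. X t \<omega> - t *\<^sub>R \<theta> - x) (\<lambda>t. Y t \<omega>) (\<lambda>t. Z t \<omega>)"
    using ae start AE_space
  proof eventually_elim
    case (elim \<omega>)
    note Z' = Z[of \<omega>]
    show ?case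
      unfolding reflected_path_def
    proof (intro allI conjI ballI impI)
      fix T t :: real assume t: "t \<in> {0..T}"
      then show "Z t \<omega> = x + t *\<^sub>R \<theta> + (X t \<omega> - t *\<^sub>R \<theta> - x) + R *v Y t \<omega>" using elim(1) by simp
      show "0 \<le> Z t \<omega> $ l" for l using Z' elim(3) P(2) t unfolding nonneg_orthant_def by auto
    next
      fix T :: real
      show "continuous_on {0..T} (\<lambda>t. Z t \<omega>)"
        using Z' elim(3) P(2) by (auto intro: continuous_on_subset)
      show "X 0 \<omega> - 0 *\<^sub>R \<theta> - x = 0" "Y 0 \<omega> = 0" using elim by auto
      show "mono_on {0..T} (\<lambda>t. Y t \<omega> $ l)" for l
        using elim(1) by (auto intro: mono_on_subset)
    next
      fix T l s t assume h: "0 \<le> s \<and> s \<le> t \<and> t \<le> T \<and> (\<forall>r\<in>{s<..t}. 0 < Z r \<omega> $ l)"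
      have "continuous_on {0..} (\<lambda>t. Y t \<omega> $ l)" using elim(1) by (auto intro!: continuous_intros)
      then show "Y t \<omega> $ l = Y s \<omega> $ l"
        using elim(1) h by (intro flat_where_integrand_positive[where g = "\<lambda>s. Z s \<omega> $ l"]) auto
    qed
  qed
  ultimately show thesis using that[of "\<lambda>t \<omega>. X t \<omega> - t *\<^sub>R \<theta>" Y] P(1) W by blast
qed

lemma hitting_time_ge:
  assumes "\<And>t. t \<in> {0..T} \<Longrightarrow> Z t \<omega> \<notin> A"
  shows "ennreal T \<le> hitting_time Z A \<omega>"
  unfolding hitting_time_def
proof (rule INF_greatest)
  fix t assume "t \<in> {t. 0 \<le> t \<and> Z t \<omega> \<in> A}"
  then have "T \<le> t" using assms[of t] by force
  then show "ennreal T \<le> ennreal t" by (rule ennreal_leI)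
qed

lemma openin_orthant_unit_cube:
  "openin (top_of_set nonneg_orthant) (nonneg_orthant \<inter> {z :: real ^ 'n. \<forall>l. z $ l < 1})"
proof -
  have "{z :: real ^ 'n. \<forall>l. z $ l < 1} = (\<Inter>l. {z. z $ l < 1})" by auto
  moreover have "open (\<Inter>l. {z :: real ^ 'n. z $ l < 1})"
    by (intro open_INT ballI open_Collect_less continuous_intros) auto
  ultimately show ?thesis by (simp add: openin_open_Int)
qed

text \<open>
  The open neighbourhood of the origin is the part of the orthant in which every coordinate is less
  than \<open>1\<close>; a confined path has not entered it. So the hitting time exceeds \<open>T\<close> with probability at
  least a multiple of \<open>1 / T\<close>.
\<close>

lemma escape_imp_not_positive_recurrent:
  fixes Z :: "real \<Rightarrow> 'w \<Rightarrow> real ^ 'n"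
  assumes spd: "symmetric_positive_definite \<Gamma>" and srbm: "srbm M F P Z \<theta> \<Gamma> R"
    and escape: "escapes_under_confined_noise \<theta> R"
  shows "\<not> positive_recurrent P Z"
proof -
  obtain a \<epsilon> where \<epsilon>: "0 < \<epsilon>" and esc: "\<forall>n\<ge>2. \<exists>x\<in>nonneg_orthant. \<forall>T b y z.
        reflected_path \<theta> R x T b y z \<and> confined_noise a \<epsilon> n T b \<longrightarrow> (\<forall>t\<in>{0..T}. \<exists>l. 1 \<le> z t $ l)"
    using escape unfolding escapes_under_confined_noise_def by blast
  define C where "C = enn2real (quartic_moment \<Gamma>)"
  define K where "K = l1_norm a"
  \<comment> \<open>The scale \<open>n\<close> has to satisfy \<open>D / n \<le> n / 2\<close>.\<close>
  define D where "D = (K + 1 / \<epsilon>) * (C / \<epsilon> ^ 3)"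
  define n where "n = 2 + 2 * D"
  have K: "0 \<le> K" unfolding K_def by (rule l1_norm_nonneg)
  have D: "0 \<le> D" unfolding D_def C_def using K \<epsilon> by simp
  then have n: "2 \<le> n" unfolding n_def by simp
  have large: "(l1_norm a + 1 / \<epsilon>) * (C / \<epsilon> ^ 3 / n) \<le> n / 2"
  proof -
    have "D / n \<le> D" using D n by (simp add: divide_le_eq mult_le_cancel_left1)
    then have "D / n \<le> n / 2" using n_def by linarith
    then show ?thesis unfolding D_def K_def by simp
  qed
  obtain x where x: "x \<in> nonneg_orthant"
    and away: "\<forall>T b y z. reflected_path \<theta> R x T b y z \<and> confined_noise a \<epsilon> n T b \<longrightarrow>
      (\<forall>t\<in>{0..T}. \<exists>l. 1 \<le> z t $ l)"
    by (rule bexE[OF mp[OF spec[OF esc] n]])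
  obtain W Y where Q: "prob_space (P x)" "filtered_space (P x) F"
    and bm: "driftless_brownian_motion (P x) x \<Gamma> W" and mart: "martingale (P x) F W"
    and path: "AE \<omega> in P x. \<forall>T. reflected_path \<theta> R x T (\<lambda>t. W t \<omega> - x) (\<lambda>t. Y t \<omega>) (\<lambda>t. Z t \<omega>)"
    using srbm_decomposition[OF srbm x] by blast
  interpret prob_space "P x" by (rule Q)
  interpret quartic_martingale "P x" F W x C
  proof
    show "AE \<omega> in P x. W 0 \<omega> = x" using bm unfolding driftless_brownian_motion_def by blast
    show "filtered_space (P x) F" "martingale (P x) F W" by (fact Q mart)+
    show "integrable (P x) (\<lambda>\<omega>. quartic (W t \<omega> - x))"
      "(\<integral>\<omega>. quartic (W t \<omega> - x) \<partial>P x) = C * t\<^sup>2" if "0 \<le> t" for t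
      unfolding C_def using driftless_brownian_motion_quartic[OF spd Q(1) bm that] .
  qed
  have cont: "AE \<omega> in P x. continuous_on {0..} (\<lambda>t. W t \<omega>)"
    using bm unfolding driftless_brownian_motion_def by blast
  have "\<exists>E. E \<in> sets (P x) \<and> n / 2 \<le> prob E * (n + K * (\<epsilon> * (n + real (Suc k)))) \<and>
      (AE \<omega> in P x. \<omega> \<in> E \<longrightarrow> confined_noise a \<epsilon> n (real (Suc k)) (\<lambda>t. W t \<omega> - x))" for k
  proof -
    have "0 < n" "0 < real (Suc k)" using n by auto
    from confinement_event[OF \<epsilon> this large cont] show ?thesis unfolding K_def by blast
  qed
  then have "\<exists>E. \<forall>k. E k \<in> sets (P x) \<and> n / 2 \<le> prob (E k) * (n + K * (\<epsilon> * (n + real (Suc k)))) \<and>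
      (AE \<omega> in P x. \<omega> \<in> E k \<longrightarrow> confined_noise a \<epsilon> n (real (Suc k)) (\<lambda>t. W t \<omega> - x))"
    by (intro choice allI)
  then obtain E where E: "\<And>k. E k \<in> sets (P x)"
    "\<And>k. n / 2 \<le> prob (E k) * (n + K * (\<epsilon> * (n + real (Suc k))))"
    "\<And>k. AE \<omega> in P x. \<omega> \<in> E k \<longrightarrow> confined_noise a \<epsilon> n (real (Suc k)) (\<lambda>t. W t \<omega> - x)"
    by blast
  define A where "A = nonneg_orthant \<inter> {z :: real ^ 'n. \<forall>l. z $ l < 1}"
  define G where "G = n + K * (\<epsilon> * (n + 1))"
  have G: "0 < G" unfolding G_def using n K \<epsilon> by (auto intro!: add_pos_nonneg)
  have "(\<integral>\<^sup>+ \<omega>. hitting_time Z A \<omega> \<partial>P x) = \<infinity>"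
  proof (rule infinite_expectation_of_harmonic_tail[OF Q(1) E(1), of "n / 2 / G"])
    show "0 < n / 2 / G" using n G by simp
    show "n / 2 / G / real (Suc k) \<le> prob (E k)" for k
    proof -
      define T where "T = real (Suc k)"
      have T: "1 \<le> T" unfolding T_def by simp
      have "n + K * (\<epsilon> * (n + T)) \<le> n * T + K * (\<epsilon> * (n * T + T))"
        using T n K \<epsilon> by (intro add_mono mult_left_mono) auto
      also have "\<dots> = G * T" unfolding G_def by (simp add: algebra_simps)
      finally have "prob (E k) * (n + K * (\<epsilon> * (n + T))) \<le> prob (E k) * (G * T)"
        by (intro mult_left_mono) auto
      then have "n / 2 \<le> prob (E k) * (G * T)" using E(2)[of k] unfolding T_def by linarith
      then show ?thesis using G T unfolding T_def[symmetric] by (simp add: divide_le_eq mult.assoc)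
    qed
    show "AE \<omega> in P x. \<omega> \<in> E k \<longrightarrow> ennreal (real (Suc k)) \<le> hitting_time Z A \<omega>" for k
      using E(3)[of k] path
    proof eventually_elim
      case (elim \<omega>)
      show ?case
      proof
        assume "\<omega> \<in> E k"
        then have noise: "confined_noise a \<epsilon> n (real (Suc k)) (\<lambda>t. W t \<omega> - x)" using elim(1) by blast
        show "ennreal (real (Suc k)) \<le> hitting_time Z A \<omega>"
        proof (rule hitting_time_ge)
          fix t assume "t \<in> {0..real (Suc k)}"
          then have "\<exists>l. 1 \<le> Z t \<omega> $ l" using away elim(2) noise by blast
          then show "Z t \<omega> \<notin> A"
            unfolding A_def by (auto simp: not_less)
        qed
      qed
    qed
  qed
  moreover have "openin (top_of_set nonneg_orthant) A" unfolding A_def by (rule openin_orthant_unit_cube)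
  moreover have "0 \<in> A" unfolding A_def nonneg_orthant_def by simp
  ultimately show ?thesis using x unfolding positive_recurrent_def by (metis less_irrefl)
qed

theorem theorem4:
  fixes \<theta> :: "real ^ 3" and \<Gamma> R :: "real ^ 3 ^ 3"
    and M :: "'w measure" and F :: "real \<Rightarrow> 'w measure"
    and P :: "real ^ 3 \<Rightarrow> 'w measure" and Z :: "real \<Rightarrow> 'w \<Rightarrow> real ^ 3"
  assumes "symmetric_positive_definite \<Gamma>"
    and "completely_S R"
    and "\<forall>i. R $ i $ i = 1"
    and "srbm M F P Z \<theta> \<Gamma> R"
    and "invertible R"
    and "\<forall>i. (matrix_inv R *v \<theta>) $ i < 0"
    and "\<exists>u v. divergent_lcp_solution \<theta> R u v"
  shows "\<not> positive_recurrent P Z"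
proof -
  obtain u v where uv: "divergent_lcp_solution \<theta> R u v" using assms(7) by blast
  have "R *v (- (matrix_inv R *v \<theta>)) = - \<theta>"
    using matrix_inv_mult_vec(1)[OF assms(5), of \<theta>] by (simp add: vec.neg)
  moreover have "\<forall>l. 0 < (- (matrix_inv R *v \<theta>)) $ l" using assms(6) by simp
  ultimately have "escapes_under_confined_noise \<theta> R"
    by (rule escape_of_divergent_lcp[OF assms(2,3) _ _ uv])
  then show ?thesis by (rule escape_imp_not_positive_recurrent[OF assms(1,4)])
qed

end
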